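(* Let $c\in\{0,1,2\}$ and let $\pi$ and $\pi'$ be two $c$-cyclic degree sequences with $\pi\lhd\pi'$. Let $\alpha>1$, let $G$ be a graph with maximum $SO_\alpha$ in $\Gamma(\pi)$ and $G'$ a graph with maximum $SO_\alpha$ in $\Gamma(\pi')$. Then $SO_\alpha(G)<SO_\alpha(G')$.
   Context: Graphs are simple, undirected, connected. A connected graph with $n$ vertices and $n+c-1$ edges is $c$-cyclic, and a $c$-cyclic degree sequence is the (non-increasingly ordered) degree sequence of some $c$-cyclic graph. $\Gamma(\pi)$ is the class of connected graphs with degree sequence $\pi$. $SO_\alpha(G)=\sum_{uv\in E(G)}[d(u)^2+d(v)^2]^\alpha$, with $d(u)$ the degree of $u$. For two different non-increasing real sequences $(x)=(x_1,\ldots,x_n)$ and $(y)=(y_1,\ldots,y_n)$, $(x)\lhd(y)$ means $\sum_{i=1}^n x_i=\sum_{i=1}^n y_i$ and $\sum_{i=1}^j x_i\le\sum_{i=1}^j y_i$ for all $j=1,\ldots,n$. *)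

theory Defs
  imports Complex_Main "HOL-Library.Multiset"
begin

record 'a ugraph =
  verts :: "'a set"
  edges :: "'a set set"

definition simple_graph :: "'a ugraph \<Rightarrow> bool" where
  "simple_graph G \<longleftrightarrow>
     finite (verts G) \<and> (\<forall>e\<in>edges G. e \<subseteq> verts G \<and> card e = 2)"

definition connected_graph :: "'a ugraph \<Rightarrow> bool" where
  "connected_graph G \<longleftrightarrow>
     simple_graph G \<and> verts G \<noteq> {} \<and>
     (\<forall>u\<in>verts G. \<forall>v\<in>verts G. (u, v) \<in> {(x, y). {x, y} \<in> edges G}\<^sup>*)"

definition degree :: "'a ugraph \<Rightarrow> 'a \<Rightarrow> nat" where
  "degree G v = card {e \<in> edges G. v \<in> e}"

definition degree_sequence :: "'a ugraph \<Rightarrow> nat list" where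
  "degree_sequence G =
     rev (sorted_list_of_multiset (image_mset (degree G) (mset_set (verts G))))"

definition c_cyclic :: "nat \<Rightarrow> 'a ugraph \<Rightarrow> bool" where
  "c_cyclic c G \<longleftrightarrow> connected_graph G \<and> card (edges G) + 1 = card (verts G) + c"

text \<open>Every finite graph has an isomorphic copy with vertices in \<^typ>\<open>nat\<close>, so quantifying over
  such graphs loses no degree sequence.\<close>

definition c_cyclic_degree_sequence :: "nat \<Rightarrow> nat list \<Rightarrow> bool" where
  "c_cyclic_degree_sequence c \<pi> \<longleftrightarrow>
     (\<exists>G :: nat ugraph. c_cyclic c G \<and> degree_sequence G = \<pi>)"

definition \<Gamma> :: "nat list \<Rightarrow> 'a ugraph set" where
  "\<Gamma> \<pi> = {G. connected_graph G \<and> degree_sequence G = \<pi>}"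

text \<open>An edge is its two-element set of endpoints, so the inner sum is \<open>d(u)\<^sup>2 + d(v)\<^sup>2\<close>.\<close>

definition SO :: "real \<Rightarrow> 'a ugraph \<Rightarrow> real" where
  "SO \<alpha> G = (\<Sum>e\<in>edges G. (\<Sum>u\<in>e. (real (degree G u))\<^sup>2) powr \<alpha>)"

definition majorized_by :: "real list \<Rightarrow> real list \<Rightarrow> bool" where
  "majorized_by x y \<longleftrightarrow>
     length x = length y \<and> x \<noteq> y \<and> sorted_wrt (\<ge>) x \<and> sorted_wrt (\<ge>) y \<and>
     sum_list x = sum_list y \<and>
     (\<forall>j\<in>{1..length x}. sum_list (take j x) \<le> sum_list (take j y))"

end

theory Submission imports Defs begin

text \<open>
  Write \<open>f(x, y) = (x\<^sup>2 + y\<^sup>2)\<^sup>\<alpha>\<close>. For \<open>\<alpha> > 1\<close> this function is increasing, convex in each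
  variable and supermodular, and it grows when a larger argument gains what a smaller one loses.

  Majorization is compared through \<open>\<Phi>(t) = \<Sum>\<^sub>x max(d(x) - t, 0)\<close>: if \<open>\<pi>\<close> is majorized by \<open>\<pi>'\<close> then
  \<open>\<Phi> \<le> \<Phi>'\<close>, and on a maximal interval where \<open>\<Phi> < \<Phi>'\<close> there are two vertices \<open>u, v\<close> with degrees
  \<open>a \<ge> b \<ge> 2\<close> in that interval. Raising \<open>d(u)\<close> and lowering \<open>d(v)\<close> by one adds 1 to \<open>\<Phi>\<close> exactly on
  \<open>[b, a]\<close>, so \<open>\<pi>'\<close> is reached by finitely many such transfers, and it suffices to realise each of
  them by a connected graph of larger weight.

  If some neighbour of \<open>v\<close> is not adjacent to \<open>u\<close>, redistribute the private neighbours of \<open>u\<close> and \<open>v\<close>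
  so that \<open>u\<close> gets the larger degrees and one vertex more; when \<open>u\<close> and \<open>v\<close> are at distance at least 3,
  one neighbour of each on a connecting path is kept apart in order to preserve connectedness.
  Otherwise the neighbourhood of \<open>v\<close> is nested in that of \<open>u\<close>. For \<open>c \<le> 2\<close> every set \<open>X\<close> of vertices
  spans at most \<open>|X| + c - 1\<close> edges, which forces \<open>b \<le> 3\<close> and leaves a few configurations, each
  settled by exchanging two edges. Here one uses that \<open>\<pi>'\<close> is realisable: \<open>u\<close> is not adjacent to all
  other vertices, and if \<open>b = 2\<close> at least \<open>c + 3\<close> vertices have degree at least 2.
\<close>

section \<open>Graphs as edge sets and their sparsity\<close>

definition nbr :: "'a set set \<Rightarrow> 'a \<Rightarrow> 'a set" where
  "nbr E x = {y. {x, y} \<in> E}"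

abbreviation deg :: "'a set set \<Rightarrow> 'a \<Rightarrow> nat" where
  "deg E x \<equiv> card (nbr E x)"

definition adj :: "'a set set \<Rightarrow> ('a \<times> 'a) set" where
  "adj E = {(x, y). {x, y} \<in> E}"

definition sgraph :: "'a set \<Rightarrow> 'a set set \<Rightarrow> bool" where
  "sgraph V E \<longleftrightarrow> finite V \<and> (\<forall>e\<in>E. e \<subseteq> V \<and> card e = 2)"

text \<open>Vertex set and edge set are separate arguments because the switches below replace
  \<open>E\<close> while \<open>V\<close> stays fixed.\<close>

definition cgraph :: "nat \<Rightarrow> 'a set \<Rightarrow> 'a set set \<Rightarrow> bool" where
  "cgraph c V E \<longleftrightarrow> sgraph V E \<and> V \<noteq> {} \<and> (\<forall>x\<in>V. \<forall>y\<in>V. (x, y) \<in> (adj E)\<^sup>*) \<and>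
     card E + 1 = card V + c"

lemma nbr_iff: "y \<in> nbr E x \<longleftrightarrow> {x, y} \<in> E"
  by (simp add: nbr_def)

lemma nbr_sym: "y \<in> nbr E x \<longleftrightarrow> x \<in> nbr E y"
  by (simp add: nbr_def insert_commute)

lemma sgraph_finite_edges: "sgraph V E \<Longrightarrow> finite E"
  unfolding sgraph_def by (meson Pow_iff finite_Pow_iff finite_subset subsetI)

lemma sgraph_finite_verts: "sgraph V E \<Longrightarrow> finite V"
  by (simp add: sgraph_def)

lemma sgraph_edgeD: "sgraph V E \<Longrightarrow> {x, y} \<in> E \<Longrightarrow> x \<in> V \<and> y \<in> V \<and> x \<noteq> y"
  unfolding sgraph_def by (metis card_2_iff doubleton_eq_iff insert_subset)

lemma sgraph_edgeE:
  assumes "sgraph V E" "e \<in> E"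
  obtains x y where "e = {x, y}" "x \<noteq> y" "x \<in> V" "y \<in> V"
  using assms unfolding sgraph_def by (metis card_2_iff insert_subset)

lemma sgraphI:
  assumes "finite V" "\<And>e. e \<in> E \<Longrightarrow> \<exists>x y. e = {x, y} \<and> x \<noteq> y \<and> x \<in> V \<and> y \<in> V"
  shows "sgraph V E"
  using assms unfolding sgraph_def by (metis card_2_iff empty_subsetI insert_subset)

lemma nbr_subset: "sgraph V E \<Longrightarrow> nbr E x \<subseteq> V"
  by (auto simp: nbr_def dest: sgraph_edgeD)

lemma nbr_irrefl: "sgraph V E \<Longrightarrow> x \<notin> nbr E x"
  using sgraph_edgeD[of V E x x] by (auto simp: nbr_def)

lemma finite_nbr: "sgraph V E \<Longrightarrow> finite (nbr E x)"
  using nbr_subset sgraph_finite_verts finite_subset by metis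

lemma edges_at_eq: "sgraph V E \<Longrightarrow> {e \<in> E. x \<in> e} = (\<lambda>y. {x, y}) ` nbr E x"
proof -
  assume sg: "sgraph V E"
  have "e \<in> (\<lambda>y. {x, y}) ` nbr E x" if e: "e \<in> E" "x \<in> e" for e
  proof -
    obtain a b where ab: "e = {a, b}" using sgraph_edgeE[OF sg e(1)] by metis
    then have "e = {x, b} \<or> e = {x, a}" using e(2) by auto
    then show ?thesis using e(1) by (auto simp: nbr_def)
  qed
  then show ?thesis by (auto simp: nbr_def)
qed

lemma inj_doubleton: "inj_on (\<lambda>y. {x, y}) A"
  by (auto simp: inj_on_def doubleton_eq_iff)

lemma deg_eq_card_edges: "sgraph V E \<Longrightarrow> deg E x = card {e \<in> E. x \<in> e}"
  by (simp add: edges_at_eq card_image inj_doubleton)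

lemma handshake:
  assumes "sgraph V E"
  shows "(\<Sum>x\<in>V. deg E x) = 2 * card E"
proof -
  have "(\<Sum>x\<in>V. deg E x) = (\<Sum>x\<in>V. card {e \<in> E. x \<in> e})"
    by (simp add: deg_eq_card_edges[OF assms])
  also have "\<dots> = (\<Sum>e\<in>E. card {x \<in> V. x \<in> e})"
    using assms sgraph_finite_edges[OF assms] sgraph_finite_verts[OF assms]
    by (intro sum_multicount_gen) auto
  also have "\<dots> = (\<Sum>e\<in>E. 2)"
  proof (rule sum.cong[OF refl])
    fix e assume "e \<in> E"
    then have "e \<subseteq> V" "card e = 2" using assms by (auto simp: sgraph_def)
    moreover from \<open>e \<subseteq> V\<close> have "{x \<in> V. x \<in> e} = e" by auto
    ultimately show "card {x \<in> V. x \<in> e} = 2" by simp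
  qed
  finally show ?thesis by simp
qed

lemma sym_adj_rtrancl: "(x, y) \<in> (adj E)\<^sup>* \<Longrightarrow> (y, x) \<in> (adj E)\<^sup>*"
proof -
  have "sym (adj E)" by (auto simp: sym_def adj_def insert_commute)
  then show "(x, y) \<in> (adj E)\<^sup>* \<Longrightarrow> (y, x) \<in> (adj E)\<^sup>*"
    by (meson sym_rtrancl symD)
qed

lemma adjI: "y \<in> nbr E x \<Longrightarrow> (x, y) \<in> (adj E)\<^sup>*"
  by (auto simp: nbr_def adj_def)

lemma cgraph_sgraph: "cgraph c V E \<Longrightarrow> sgraph V E"
  by (simp add: cgraph_def)

text \<open>A walk from \<open>X\<close> to its complement must cross the boundary; the induction
  follows it until it does.\<close>

lemma cgraph_exit_edge:
  assumes G: "cgraph c V E" and X: "X \<subseteq> V" "X \<noteq> {}" "X \<noteq> V"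
  obtains x y where "x \<in> X" "y \<in> V - X" "{x, y} \<in> E"
proof -
  obtain a b where ab: "a \<in> X" "b \<in> V - X" using X by blast
  have "(a, b) \<in> (adj E)\<^sup>*" using G ab X unfolding cgraph_def by blast
  then have "b \<in> X \<or> (\<exists>x y. x \<in> X \<and> y \<in> V - X \<and> {x, y} \<in> E)"
  proof (induction rule: rtrancl_induct)
    case base then show ?case using ab by simp
  next
    case (step y z)
    then show ?case using sgraph_edgeD[OF cgraph_sgraph[OF G]] by (auto simp: adj_def)
  qed
  then show thesis using ab that by blast
qed

lemma cgraph_deg_pos:
  assumes "cgraph c V E" "x \<in> V" "card V \<ge> 2"
  shows "deg E x \<ge> 1"
proof -
  have "V \<noteq> {x}" using assms(3) by auto
  then obtain a y where "a \<in> {x}" "y \<in> V - {x}" "{a, y} \<in> E"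
    using cgraph_exit_edge[OF assms(1), of "{x}"] assms(2) by blast
  then have "y \<in> nbr E x" by (simp add: nbr_iff)
  then show ?thesis using finite_nbr[OF cgraph_sgraph[OF assms(1)]]
    by (metis One_nat_def Suc_leI card_gt_0_iff empty_iff)
qed

section \<open>Edges spanned by a vertex set: sparsity and tight sets\<close>

definition inside :: "'a set set \<Rightarrow> 'a set \<Rightarrow> 'a set set" where
  "inside E X = {e \<in> E. e \<subseteq> X}"

lemma finite_inside: "sgraph V E \<Longrightarrow> finite (inside E X)"
  by (simp add: inside_def sgraph_finite_edges)

lemma card_inside_insert:
  assumes "sgraph V E" "y \<notin> X"
  shows "card (inside E (insert y X)) = card (inside E X) + card (nbr E y \<inter> X)"
proof -
  have "inside E (insert y X) = inside E X \<union> (\<lambda>x. {y, x}) ` (nbr E y \<inter> X)"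
  proof -
    have "e \<in> inside E X \<union> (\<lambda>x. {y, x}) ` (nbr E y \<inter> X)" if e: "e \<in> E" "e \<subseteq> insert y X" for e
    proof (cases "y \<in> e")
      case True
      then obtain x where "e = {y, x}" "x \<in> nbr E y" using edges_at_eq[OF assms(1), of y] e by blast
      moreover from this have "x \<in> X" using e nbr_irrefl[OF assms(1), of y] by auto
      ultimately show ?thesis by blast
    next
      case False then show ?thesis using e by (auto simp: inside_def)
    qed
    then show ?thesis by (auto simp: inside_def nbr_def)
  qed
  moreover have "inside E X \<inter> (\<lambda>x. {y, x}) ` (nbr E y \<inter> X) = {}"
    using assms(2) by (auto simp: inside_def)
  ultimately show ?thesis
    using finite_nbr[OF assms(1)] finite_inside[OF assms(1)]
    by (simp add: card_Un_disjoint card_image inj_doubleton)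
qed

text \<open>Growing \<open>X\<close> to \<open>V\<close> along exit edges adds at least one edge per
  new vertex, so edges minus vertices never decreases, and it ends at \<open>c - 1\<close>.\<close>

lemma cgraph_sparse:
  assumes G: "cgraph c V E" and X: "X \<subseteq> V" "X \<noteq> {}"
  shows "card (inside E X) + 1 \<le> card X + c"
  using X
proof (induction "card (V - X)" arbitrary: X)
  case 0
  have "finite V" using G by (simp add: cgraph_def sgraph_def)
  with 0 have "X = V" by auto
  moreover have "inside E V = E" using G by (auto simp: inside_def cgraph_def sgraph_def)
  ultimately show ?case using G by (simp add: cgraph_def)
next
  case (Suc k)
  have fin: "finite V" using G by (simp add: cgraph_def sgraph_def)
  have "X \<noteq> V" using Suc by auto
  then obtain x y where xy: "x \<in> X" "y \<in> V - X" "{x, y} \<in> E"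
    using cgraph_exit_edge[OF G Suc.prems] by blast
  have "V - insert y X = (V - X) - {y}" by auto
  then have "k = card (V - insert y X)" using Suc(2) xy(2) fin by simp
  then have "card (inside E (insert y X)) + 1 \<le> card (insert y X) + c"
    using Suc.hyps(1) xy(2) Suc.prems by simp
  moreover have "x \<in> nbr E y \<inter> X" using xy by (simp add: nbr_def insert_commute)
  then have "card (nbr E y \<inter> X) \<ge> 1"
    using finite_nbr[OF cgraph_sgraph[OF G]]
    by (metis One_nat_def Suc_leI card_gt_0_iff empty_iff finite_Int)
  moreover have "card (insert y X) = card X + 1"
    using xy(2) finite_subset[OF Suc.prems(1) fin] by simp
  ultimately show ?case using card_inside_insert[OF cgraph_sgraph[OF G], of y X] xy(2) by simp
qed

text \<open>The form used for counting: explicit edges \<open>F\<close> on a small set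
  \<open>X\<close> force \<open>c\<close> to be large or are contradictory.\<close>

lemma cgraph_sparse_edges:
  assumes G: "cgraph c V E" and X: "X \<subseteq> V" "X \<noteq> {}" and F: "F \<subseteq> E" "\<And>e. e \<in> F \<Longrightarrow> e \<subseteq> X"
  shows "card F + 1 \<le> card X + c"
proof -
  have "card F \<le> card (inside E X)"
    using F by (intro card_mono finite_inside[OF cgraph_sgraph[OF G]]) (auto simp: inside_def)
  then show ?thesis using cgraph_sparse[OF G X] by simp
qed

text \<open>The equality case of \<open>cgraph_sparse\<close>, written without subtraction and only
  as the inequality that sparsity does not supply. In a c-cyclic graph such a nonempty set carries
  all independent cycles.\<close>

definition tight :: "nat \<Rightarrow> 'a set set \<Rightarrow> 'a set \<Rightarrow> bool" where
  "tight c E X \<longleftrightarrow> card X + c \<le> card (inside E X) + 1"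

text \<open>The edge from \<open>y\<close> into \<open>X\<close> makes up for the additional
  vertex.\<close>

lemma tight_insert:
  assumes "sgraph V E" "tight c E X" "finite X" "y \<notin> X" "x \<in> X" "x \<in> nbr E y"
  shows "tight c E (insert y X)"
proof -
  have "card (nbr E y \<inter> X) \<ge> 1"
    using finite_nbr[OF assms(1)] assms(5,6)
    by (metis IntI One_nat_def Suc_leI card_gt_0_iff empty_iff finite_Int)
  then show ?thesis using assms card_inside_insert[OF assms(1,4)] by (simp add: tight_def)
qed

lemma tight_Un:
  assumes "sgraph V E" "tight c E X" "finite X" "finite Y"
    and "\<And>y. y \<in> Y \<Longrightarrow> \<exists>x\<in>X. x \<in> nbr E y"
  shows "tight c E (X \<union> Y)"
  using assms(4,5)
proof (induction Y rule: finite_induct)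
  case empty then show ?case using assms by simp
next
  case (insert y Y)
  then have t: "tight c E (X \<union> Y)" by simp
  show ?case
  proof (cases "y \<in> X \<union> Y")
    case True then show ?thesis using t by (simp add: insert_absorb)
  next
    case False
    obtain x where "x \<in> X" "x \<in> nbr E y" using insert by blast
    then show ?thesis
      using tight_insert[OF assms(1) t _ False, of x] assms(3) insert by simp
  qed
qed

text \<open>Absorb vertices along exit edges; tightness survives each time. The last vertex absorbed
  can then account for at most one edge, so it is a leaf.\<close>

lemma tight_leaf_outside:
  assumes G: "cgraph c V E" and "tight c E X" "X \<subseteq> V" "X \<noteq> {}" "X \<noteq> V"
  shows "\<exists>l\<in>V - X. deg E l = 1"
  using assms(2-)
proof (induction "card (V - X)" arbitrary: X rule: less_induct)
  case (less X)
  note sg = cgraph_sgraph[OF G]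
  have fin: "finite V" "finite X"
    using sgraph_finite_verts[OF sg] less.prems finite_subset by auto
  obtain x y where xy: "x \<in> X" "y \<in> V - X" "{x, y} \<in> E"
    using cgraph_exit_edge[OF G] less.prems by metis
  have x: "x \<in> nbr E y" using xy by (simp add: nbr_def insert_commute)
  have t: "tight c E (insert y X)" using tight_insert[OF sg] less.prems xy x fin by blast
  show ?case
  proof (cases "insert y X = V")
    case False
    have "card (V - insert y X) < card (V - X)"
      using xy fin by (intro psubset_card_mono) auto
    then show ?thesis using less.hyps[of "insert y X"] t False less.prems xy by auto
  next
    case True
    have "inside E V = E" using sg by (auto simp: inside_def sgraph_def)
    then have "card E = card (inside E X) + card (nbr E y \<inter> X)"
      using card_inside_insert[OF sg, of y X] xy True by simp
    moreover have "nbr E y \<inter> X = nbr E y"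
      using nbr_subset[OF sg, of y] nbr_irrefl[OF sg, of y] True by blast
    moreover have "card V = card X + 1" using True xy fin by (metis DiffD2 Suc_eq_plus1 card_insert_disjoint)
    moreover have "card E + 1 = card V + c" using G by (simp add: cgraph_def)
    ultimately have "deg E y \<le> 1" using less.prems(1) by (simp add: tight_def)
    moreover have "deg E y \<noteq> 0" using x finite_nbr[OF sg] by auto
    ultimately show ?thesis using xy by (intro bexI[of _ y]) auto
  qed
qed

section \<open>Splitting edge sums at two vertices; preserving connectedness\<close>

lemma sum_edges_split:
  fixes g :: "'a set \<Rightarrow> real"
  assumes sg: "sgraph V E" and uv: "u \<noteq> v"
  shows "sum g E = sum g {e \<in> E. u \<notin> e \<and> v \<notin> e} + (\<Sum>y\<in>nbr E u - {v}. g {u, y}) +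
     (\<Sum>y\<in>nbr E v - {u}. g {v, y}) + (if {u, v} \<in> E then g {u, v} else 0)"
proof -
  let ?E0 = "{e \<in> E. u \<notin> e \<and> v \<notin> e}"
  let ?U = "(\<lambda>y. {u, y}) ` (nbr E u - {v})" and ?V = "(\<lambda>y. {v, y}) ` (nbr E v - {u})"
  let ?J = "if {u, v} \<in> E then {{u, v}} else {}"
  have "E = ?E0 \<union> (?U \<union> (?V \<union> ?J))"
  proof -
    have "e \<in> ?U \<union> (?V \<union> ?J)" if e: "e \<in> E" "u \<in> e \<or> v \<in> e" for e
    proof (cases "e = {u, v}")
      case True then show ?thesis using e by auto
    next
      case False
      have "e \<in> (\<lambda>y. {u, y}) ` nbr E u \<union> (\<lambda>y. {v, y}) ` nbr E v"
        using e edges_at_eq[OF sg, of u] edges_at_eq[OF sg, of v] by blast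
      then show ?thesis using False by (auto simp: insert_commute)
    qed
    moreover have "?U \<union> (?V \<union> ?J) \<subseteq> E" by (auto simp: nbr_def)
    ultimately show ?thesis by blast
  qed
  moreover have "?E0 \<inter> (?U \<union> (?V \<union> ?J)) = {}" by auto
  moreover have "?U \<inter> (?V \<union> ?J) = {}" using uv by (auto simp: doubleton_eq_iff)
  moreover have "?V \<inter> ?J = {}" using uv by (auto simp: doubleton_eq_iff split: if_splits)
  moreover have "finite ?E0" "finite ?U" "finite ?V" "finite ?J"
    using sgraph_finite_edges[OF sg] finite_nbr[OF sg] by auto
  ultimately have "sum g E = sum g ?E0 + (sum g ?U + (sum g ?V + sum g ?J))"
    by (metis (no_types, lifting) finite_UnI sum.union_disjoint)
  moreover have "sum g ?U = (\<Sum>y\<in>nbr E u - {v}. g {u, y})"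
    by (subst sum.reindex) (auto simp: inj_doubleton)
  moreover have "sum g ?V = (\<Sum>y\<in>nbr E v - {u}. g {v, y})"
    by (subst sum.reindex) (auto simp: inj_doubleton)
  ultimately show ?thesis by simp
qed

lemma deg_split:
  assumes sg: "sgraph V E" and uv: "u \<noteq> v"
  shows "deg E u = card (nbr E u - {v}) + (if {u, v} \<in> E then 1 else 0)"
  using card_Suc_Diff1[OF finite_nbr[OF sg], of v u]
  by (auto simp: nbr_def)

text \<open>Walks can be rerouted edge by edge, so after a switch only the removed edges need a
  detour.\<close>

lemma cgraph_if_adj_le:
  assumes G: "cgraph c V E" and sg: "sgraph V H" and card: "card H = card E"
    and "\<And>x y. {x, y} \<in> E \<Longrightarrow> (x, y) \<in> (adj H)\<^sup>*"
  shows "cgraph c V H"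
proof -
  have "adj E \<subseteq> (adj H)\<^sup>*" using assms(4) by (auto simp: adj_def)
  then have "(adj E)\<^sup>* \<subseteq> (adj H)\<^sup>*" by (rule rtrancl_subset_rtrancl)
  then show ?thesis using G sg card unfolding cgraph_def by auto
qed

lemma card_edges_eq_if_deg_sum_eq:
  assumes "sgraph V E" "sgraph V H" "(\<Sum>x\<in>V. deg H x) = (\<Sum>x\<in>V. deg E x)"
  shows "card H = card E"
  using handshake[OF assms(1)] handshake[OF assms(2)] assms(3) by simp

section \<open>Edge weights and switches at nested neighbourhoods\<close>

lemma card_exchange: "finite A \<Longrightarrow> x \<notin> A \<Longrightarrow> y \<in> A \<Longrightarrow> card (insert x (A - {y})) = card A"
  by (metis Diff_iff card_Suc_Diff1 card_insert_disjoint finite_Diff)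

text \<open>These laws are what the graph arguments use of \<open>(x^2 + y^2)^\<alpha>\<close>.
  \<open>super\<close> and \<open>convex\<close> are discrete forms of nonnegative mixed and second
  derivatives; \<open>spread\<close> covers the edge joining the two vertices whose degrees
  change.\<close>

locale edge_weight =
  fixes f :: "nat \<Rightarrow> nat \<Rightarrow> real"
  assumes sym: "f x y = f y x"
    and strict: "x < x' \<Longrightarrow> f x y < f x' y"
    and super: "x \<le> x' \<Longrightarrow> y \<le> y' \<Longrightarrow> f x' y - f x y \<le> f x' y' - f x y'"
    and convex: "x \<le> x' \<Longrightarrow> f (Suc x) y - f x y \<le> f (Suc x') y - f x' y"
    and spread: "b \<le> a \<Longrightarrow> f a (Suc b) \<le> f (Suc a) b"
begin

text \<open>\<open>Min\<close> and \<open>Max\<close> read off both end degrees without choosing an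
  order of the ends, and they coincide when the two degrees are equal.\<close>

definition edge_wt :: "('a \<Rightarrow> nat) \<Rightarrow> 'a set \<Rightarrow> real" where
  "edge_wt d e = f (Min (d ` e)) (Max (d ` e))"

definition total :: "'a set set \<Rightarrow> real" where
  "total E = (\<Sum>e\<in>E. edge_wt (deg E) e)"

lemma edge_wt_doubleton: "edge_wt d {x, y} = f (d x) (d y)"
  using sym[of "d x" "d y"] by (auto simp: edge_wt_def min_def max_def)

lemma mono: "x \<le> x' \<Longrightarrow> f x y \<le> f x' y"
  using strict[of x x' y] by (cases "x = x'") auto

text \<open>\<open>convex\<close> moves the incremented argument from \<open>x\<close> to
  \<open>x'\<close>, then \<open>super\<close> raises the other one. This is how gains at
  \<open>u\<close> pay for losses at \<open>v\<close>.\<close>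

lemma increment_mono:
  assumes "x \<le> x'" "y \<le> y'"
  shows "f (Suc x) y - f x y \<le> f (Suc x') y' - f x' y'"
  using convex[OF assms(1), of y] super[of x' "Suc x'" y y'] assms(2) by simp

lemma increment_nonneg: "0 \<le> f (Suc x) y - f x y"
  using mono[of x "Suc x" y] by simp

text \<open>\<open>H\<close> realises the unit transfer from \<open>v\<close> to \<open>u\<close>;
  degree at least 1 at \<open>v\<close> keeps the truncated subtraction exact.\<close>

definition shifted :: "'a set \<Rightarrow> 'a set set \<Rightarrow> 'a \<Rightarrow> 'a \<Rightarrow> 'a set set \<Rightarrow> bool" where
  "shifted V E u v H \<longleftrightarrow> sgraph V H \<and> u \<noteq> v \<and> u \<in> V \<and> v \<in> V \<and> deg E v \<ge> 1 \<and>
     deg H u = Suc (deg E u) \<and> deg H v = deg E v - 1 \<and>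
     (\<forall>x. x \<noteq> u \<longrightarrow> x \<noteq> v \<longrightarrow> deg H x = deg E x)"

lemma shifted_card_edges:
  assumes sg: "sgraph V E" and sh: "shifted V E u v H"
  shows "card H = card E"
proof (rule card_edges_eq_if_deg_sum_eq[OF sg])
  show "sgraph V H" using sh by (simp add: shifted_def)
  have fin: "finite V" using sg by (simp add: sgraph_def)
  have eq: "(\<Sum>x\<in>V. g x) = g u + (g v + (\<Sum>x\<in>V - {u} - {v}. g x))" for g :: "'a \<Rightarrow> nat"
    using sh fin unfolding shifted_def by (subst sum.remove[of V u], simp, simp, subst sum.remove[of "V - {u}" v]) auto
  have "(\<Sum>x\<in>V - {u} - {v}. deg H x) = (\<Sum>x\<in>V - {u} - {v}. deg E x)"
    using sh by (intro sum.cong) (auto simp: shifted_def)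
  then show "(\<Sum>x\<in>V. deg H x) = (\<Sum>x\<in>V. deg E x)"
    using sh unfolding eq[of "deg H"] eq[of "deg E"] shifted_def by simp
qed

lemma total_split:
  assumes "sgraph V E" "u \<noteq> v"
  shows "total E = (\<Sum>e | e \<in> E \<and> u \<notin> e \<and> v \<notin> e. edge_wt (deg E) e) +
     (\<Sum>y\<in>nbr E u - {v}. f (deg E u) (deg E y)) + (\<Sum>y\<in>nbr E v - {u}. f (deg E v) (deg E y)) +
     (if {u, v} \<in> E then f (deg E u) (deg E v) else 0)"
  unfolding total_def by (subst sum_edges_split[OF assms]) (simp add: edge_wt_doubleton)

text \<open>Edges avoiding \<open>u\<close> and \<open>v\<close> keep their end degrees, so the new
  total can be written with the old degrees and compared termwise with
  \<open>total_split\<close>.\<close>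

lemma total_split_shifted:
  assumes sh: "shifted V E u v H"
  shows "total H = (\<Sum>e | e \<in> H \<and> u \<notin> e \<and> v \<notin> e. edge_wt (deg E) e) +
     (\<Sum>y\<in>nbr H u - {v}. f (Suc (deg E u)) (deg E y)) + (\<Sum>y\<in>nbr H v - {u}. f (deg E v - 1) (deg E y)) +
     (if {u, v} \<in> H then f (Suc (deg E u)) (deg E v - 1) else 0)"
proof -
  have sg: "sgraph V H" and uv: "u \<noteq> v" and du: "deg H u = Suc (deg E u)" and dv: "deg H v = deg E v - 1"
    and d: "\<And>x. x \<noteq> u \<Longrightarrow> x \<noteq> v \<Longrightarrow> deg H x = deg E x"
    using sh by (auto simp: shifted_def)
  have "(\<Sum>e | e \<in> H \<and> u \<notin> e \<and> v \<notin> e. edge_wt (deg H) e) = (\<Sum>e | e \<in> H \<and> u \<notin> e \<and> v \<notin> e. edge_wt (deg E) e)"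
  proof (rule sum.cong[OF refl], clarify)
    fix e assume "u \<notin> e" "v \<notin> e"
    then have "deg H x = deg E x" if "x \<in> e" for x using d[of x] that by blast
    then have "deg H ` e = deg E ` e" by (intro image_cong) auto
    then show "edge_wt (deg H) e = edge_wt (deg E) e" by (simp add: edge_wt_def)
  qed
  moreover have "(\<Sum>y\<in>nbr H u - {v}. f (deg H u) (deg H y)) = (\<Sum>y\<in>nbr H u - {v}. f (Suc (deg E u)) (deg E y))"
    using nbr_irrefl[OF sg, of u] d du by (intro sum.cong refl) (metis DiffE singletonI)
  moreover have "(\<Sum>y\<in>nbr H v - {u}. f (deg H v) (deg H y)) = (\<Sum>y\<in>nbr H v - {u}. f (deg E v - 1) (deg E y))"
    using nbr_irrefl[OF sg, of v] d dv by (intro sum.cong refl) (metis DiffE singletonI)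
  ultimately show ?thesis using total_split[OF sg uv] du dv by simp
qed

text \<open>The common comparison for a vertex \<open>v\<close> whose neighbourhood lies inside that of \<open>u\<close>: the gains at
  \<open>u\<close> along the shared neighbours pay for the losses at \<open>v\<close>, with those along \<open>K\<close> left over.\<close>

lemma nested_gain:
  assumes "finite A" "B \<subseteq> A" "K \<subseteq> B" "Suc b \<le> a"
  shows "(\<Sum>y\<in>B. f (Suc b) (d y)) + (\<Sum>y\<in>A. f a (d y))
     \<le> (\<Sum>y\<in>B - K. f b (d y)) + (\<Sum>y\<in>A. f (Suc a) (d y)) + (\<Sum>y\<in>K. f b (d y))"
proof -
  have fin: "finite B" using assms finite_subset by blast
  have "(\<Sum>y\<in>B. f (Suc b) (d y) - f b (d y)) \<le> (\<Sum>y\<in>B. f (Suc a) (d y) - f a (d y))"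
    using assms by (intro sum_mono increment_mono) auto
  also have "\<dots> \<le> (\<Sum>y\<in>A. f (Suc a) (d y) - f a (d y))"
    using assms by (intro sum_mono2 increment_nonneg) auto
  finally have "(\<Sum>y\<in>B. f (Suc b) (d y)) - (\<Sum>y\<in>B. f b (d y)) \<le>
    (\<Sum>y\<in>A. f (Suc a) (d y)) - (\<Sum>y\<in>A. f a (d y))" by (simp add: sum_subtractf)
  moreover have "(\<Sum>y\<in>B. f b (d y)) = (\<Sum>y\<in>B - K. f b (d y)) + (\<Sum>y\<in>K. f b (d y))"
    using sum.subset_diff[OF assms(3) fin] by blast
  ultimately show ?thesis by simp
qed

text \<open>Only the degree \<open>b\<close> of the losing vertex is fixed, not the vertex: every
  choice has the same effect on the degree multiset, and \<open>adj_improvable_2\<close> has to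
  replace \<open>v\<close> by another vertex of degree 2.\<close>

definition improvable :: "nat \<Rightarrow> 'a set \<Rightarrow> 'a set set \<Rightarrow> 'a \<Rightarrow> nat \<Rightarrow> bool" where
  "improvable c V E u b \<longleftrightarrow>
     (\<exists>v H. deg E v = b \<and> shifted V E u v H \<and> cgraph c V H \<and> total E < total H)"

lemma improvableI:
  assumes "cgraph c V E" "shifted V E u v H" "deg E v = b" "total E < total H"
    and "\<And>x y. {x, y} \<in> E \<Longrightarrow> (x, y) \<in> (adj H)\<^sup>*"
  shows "improvable c V E u b"
proof -
  have "cgraph c V H"
    using cgraph_if_adj_le[OF assms(1) _ shifted_card_edges[OF cgraph_sgraph[OF assms(1)] assms(2)] assms(5)]
      assms(2) by (simp add: shifted_def)
  then show ?thesis using assms(2-4) unfolding improvable_def by blast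
qed

text \<open>Trade \<open>{v, w}\<close> and \<open>{z, p}\<close> for \<open>{u, z}\<close> and
  \<open>{w, p}\<close>: each of \<open>w\<close>, \<open>z\<close>, \<open>p\<close> swaps one
  neighbour, \<open>u\<close> gains \<open>z\<close> and \<open>v\<close> loses \<open>w\<close>.
  Since the neighbourhoods are nested, increments at \<open>u\<close> pay for those lost at
  \<open>v\<close>.\<close>

lemma nested_two_switch:
  assumes G: "cgraph c V E" and uv: "u \<in> V" "v \<in> V" "u \<noteq> v"
    and deg: "deg E v = Suc b" "Suc b \<le> deg E u"
    and nested: "nbr E v - {u} \<subseteq> nbr E u"
    and w: "w \<in> nbr E v" "w \<noteq> u" and b: "b \<ge> 1"
    and zp: "{z, p} \<in> E" and z: "z \<notin> nbr E u" "z \<noteq> u" "z \<noteq> v" and p: "p \<notin> nbr E w" "p \<noteq> w"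
    and bp: "b \<le> deg E p" and cond: "deg E p \<le> Suc (deg E u) \<or> deg E z \<le> deg E w"
  shows "improvable c V E u (Suc b)"
proof -
  note sg = cgraph_sgraph[OF G]
  define H where "H = insert {u, z} (insert {w, p} (E - {{v, w}, {z, p}}))"
  have wu: "{u, w} \<in> E" using nested w by (auto simp: nbr_iff)
  have vw: "{v, w} \<in> E" using w by (simp add: nbr_iff)
  have uz: "{u, z} \<notin> E" using z by (simp add: nbr_iff)
  have wp: "{w, p} \<notin> E" using p by (simp add: nbr_iff)
  have ne: "z \<noteq> w" "p \<noteq> u" "p \<noteq> v" "z \<noteq> p" "w \<noteq> v" "w \<noteq> u" "z \<noteq> u" "z \<noteq> v" "p \<noteq> w"
    using wu vw uz wp zp z p w sgraph_edgeD[OF sg] by (auto simp: insert_commute)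
  have inV: "z \<in> V" "p \<in> V" "w \<in> V" using zp wu sgraph_edgeD[OF sg] by blast+
  have sgH: "sgraph V H"
  proof (rule sgraphI)
    show "finite V" using sg by (simp add: sgraph_def)
    fix e assume "e \<in> H"
    then have "e = {u, z} \<or> e = {w, p} \<or> e \<in> E" by (auto simp: H_def)
    then show "\<exists>x y. e = {x, y} \<and> x \<noteq> y \<and> x \<in> V \<and> y \<in> V"
      using ne inV uv sgraph_edgeE[OF sg, of e] by metis
  qed
  note fin = finite_nbr[OF sg]
  have nu: "nbr H u = insert z (nbr E u)"
    using ne uv unfolding nbr_def H_def by (auto simp: doubleton_eq_iff)
  have nv: "nbr H v = nbr E v - {w}"
    using ne uv unfolding nbr_def H_def by (auto simp: doubleton_eq_iff)
  have nw: "nbr H w = insert p (nbr E w - {v})"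
    using ne uv unfolding nbr_def H_def by (auto simp: doubleton_eq_iff)
  have nz: "nbr H z = insert u (nbr E z - {p})"
    using ne uv unfolding nbr_def H_def by (auto simp: doubleton_eq_iff)
  have np: "nbr H p = insert w (nbr E p - {z})"
    using ne uv unfolding nbr_def H_def by (auto simp: doubleton_eq_iff)
  have nx: "nbr H x = nbr E x" if "x \<notin> {u, v, w, z, p}" for x
    using that unfolding nbr_def H_def by (auto simp: doubleton_eq_iff)
  have mem: "v \<in> nbr E w" "u \<notin> nbr E z" "p \<in> nbr E z" "w \<notin> nbr E p" "z \<in> nbr E p" "p \<notin> nbr E w"
    using vw uz zp wp by (auto simp: nbr_iff insert_commute)
  have dw: "deg H w = deg E w" unfolding nw using mem fin[of w] by (intro card_exchange) auto
  have dz: "deg H z = deg E z" unfolding nz using mem fin[of z] by (intro card_exchange) auto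
  have dp: "deg H p = deg E p" unfolding np using mem fin[of p] by (intro card_exchange) auto
  have dx: "deg H x = deg E x" if "x \<noteq> u" "x \<noteq> v" for x
    using that dw dz dp nx[of x] by (cases "x \<in> {w, z, p}") auto
  have sh: "shifted V E u v H"
    unfolding shifted_def using sgH uv dx nu nv z fin[of u] fin[of v] w deg by auto
  have E0: "{e \<in> H. u \<notin> e \<and> v \<notin> e} = insert {w, p} ({e \<in> E. u \<notin> e \<and> v \<notin> e} - {{z, p}})"
    using ne uv unfolding H_def by auto
  let ?d = "deg E"
  let ?E0 = "{e \<in> E. u \<notin> e \<and> v \<notin> e}"
  have "sum (edge_wt ?d) {e \<in> H. u \<notin> e \<and> v \<notin> e} = sum (edge_wt ?d) ?E0 - f (?d z) (?d p) + f (?d w) (?d p)"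
  proof -
    have "{w, p} \<notin> ?E0 - {{z, p}}" using wp by auto
    moreover have "{z, p} \<in> ?E0" using zp ne by auto
    moreover have "finite ?E0" using sgraph_finite_edges[OF sg] by simp
    ultimately show ?thesis unfolding E0
      by (simp add: sum_diff1 edge_wt_doubleton)
  qed
  moreover have "nbr H u - {v} = insert z (nbr E u - {v})" using nu ne by auto
  then have "(\<Sum>y\<in>nbr H u - {v}. f (Suc (?d u)) (?d y)) =
      f (Suc (?d u)) (?d z) + (\<Sum>y\<in>nbr E u - {v}. f (Suc (?d u)) (?d y))"
    using z fin by simp
  moreover have "nbr H v - {u} = nbr E v - {u} - {w}" using nv by auto
  moreover have "{u, v} \<in> H \<longleftrightarrow> {u, v} \<in> E" using ne unfolding H_def by (auto simp: doubleton_eq_iff)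
  moreover have "(\<Sum>y\<in>nbr E v - {u}. f (Suc b) (?d y)) + (\<Sum>y\<in>nbr E u - {v}. f (?d u) (?d y))
     \<le> (\<Sum>y\<in>nbr E v - {u} - {w}. f b (?d y)) + (\<Sum>y\<in>nbr E u - {v}. f (Suc (?d u)) (?d y)) + (\<Sum>y\<in>{w}. f b (?d y))"
    using fin nested w deg nbr_irrefl[OF sg] by (intro nested_gain) auto
  moreover have "f (?d u) (Suc b) \<le> f (Suc (?d u)) b" using spread deg by simp
  \<comment> \<open>The new edges must beat \<open>{z, p}\<close> and the term left over at
    \<open>w\<close>. If \<open>w\<close> has at least the degree of \<open>z\<close>,
    supermodularity hands \<open>p\<close> to \<open>w\<close>, using
    \<open>b \<le> deg E p\<close>; otherwise \<open>cond\<close> bounds \<open>deg E p\<close>, and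
    it is \<open>z\<close> that profits from joining \<open>u\<close>.\<close>
  moreover have "f (?d z) (?d p) + f b (?d w) < f (Suc (?d u)) (?d z) + f (?d w) (?d p)"
  proof (cases "?d z \<le> ?d w")
    case True
    have "f (?d w) b - f (?d z) b \<le> f (?d w) (?d p) - f (?d z) (?d p)" using super True bp by blast
    moreover have "f b (?d z) < f (Suc (?d u)) (?d z)" using strict deg by simp
    ultimately show ?thesis using sym[of b "?d w"] sym[of b "?d z"] by simp
  next
    case False
    then have "f (?d z) (?d p) - f (?d w) (?d p) \<le> f (?d z) (Suc (?d u)) - f (?d w) (Suc (?d u))"
      using super cond by simp
    moreover have "f b (?d w) < f (Suc (?d u)) (?d w)" using strict deg by simp
    ultimately show ?thesis using sym[of "Suc (?d u)" "?d w"] sym[of "Suc (?d u)" "?d z"] by simp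
  qed
  ultimately have less: "total E < total H"
    using total_split[OF sg uv(3)] total_split_shifted[OF sh] deg by simp
  have uwH: "(u, w) \<in> (adj H)\<^sup>*" using wu nu by (intro adjI) (auto simp: nbr_iff)
  have uzH: "(u, z) \<in> (adj H)\<^sup>*" using nu by (intro adjI) auto
  have wpH: "(w, p) \<in> (adj H)\<^sup>*" using nw by (intro adjI) auto
  \<comment> \<open>Either the edge \<open>{u, v}\<close> is untouched, or \<open>v\<close> keeps a
    second neighbour, provided by \<open>b \<ge> 1\<close> and shared with \<open>u\<close>.\<close>
  have uvH: "(u, v) \<in> (adj H)\<^sup>*"
  proof (cases "u \<in> nbr E v")
    case True
    then have "v \<in> nbr H u" using nu by (simp add: nbr_sym[of v])
    then show ?thesis by (rule adjI)
  next
    case False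
    have "\<not> nbr E v \<subseteq> {w}" using card_mono[of "{w}" "nbr E v"] deg b by auto
    then obtain y where y: "y \<in> nbr E v" "y \<noteq> w" by blast
    then have "y \<in> nbr H v" "y \<in> nbr H u" using False nested nv nu by auto
    then show ?thesis using adjI sym_adj_rtrancl rtrancl_trans by metis
  qed
  have main: "(x, y) \<in> (adj H)\<^sup>*" if "{x, y} \<in> E" for x y
  proof (cases "{x, y} \<in> H")
    case True then show ?thesis by (intro adjI) (simp add: nbr_iff)
  next
    case False
    then have "{x, y} = {v, w} \<or> {x, y} = {z, p}" using that by (auto simp: H_def)
    then have "(x = v \<and> y = w \<or> x = w \<and> y = v) \<or> (x = z \<and> y = p \<or> x = p \<and> y = z)"
      by (simp only: doubleton_eq_iff)
    moreover have "(v, w) \<in> (adj H)\<^sup>*" using uvH uwH sym_adj_rtrancl rtrancl_trans by metis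
    moreover have "(z, p) \<in> (adj H)\<^sup>*" using uzH uwH wpH sym_adj_rtrancl rtrancl_trans by metis
    ultimately show ?thesis using sym_adj_rtrancl by metis
  qed
  show ?thesis using improvableI[OF G sh deg(1) less main] .
qed

text \<open>Trade \<open>{v, w}\<close> and \<open>{v, p}\<close> for \<open>{u, v}\<close> and
  \<open>{w, p}\<close>: \<open>v\<close> loses two neighbours but gains \<open>u\<close>, while
  \<open>w\<close> and \<open>p\<close> replace \<open>v\<close> by each other.\<close>

lemma nested_join_switch:
  assumes G: "cgraph c V E" and uv: "u \<in> V" "v \<in> V" "u \<noteq> v"
    and deg: "deg E v = Suc b" "Suc b \<le> deg E u"
    and nonadj: "v \<notin> nbr E u" and nested: "nbr E v \<subseteq> nbr E u"
    and w: "w \<in> nbr E v" and p: "p \<in> nbr E v" and wp: "w \<notin> nbr E p" "w \<noteq> p"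
    and b: "b \<le> deg E w" "b \<le> deg E p"
  shows "improvable c V E u (Suc b)"
proof -
  note sg = cgraph_sgraph[OF G]
  define H where "H = insert {u, v} (insert {w, p} (E - {{v, w}, {v, p}}))"
  have e: "{u, w} \<in> E" "{u, p} \<in> E" "{v, w} \<in> E" "{v, p} \<in> E" "{u, v} \<notin> E" "{w, p} \<notin> E"
    using nested nonadj w p wp nbr_sym[of w E p] by (auto simp: nbr_iff subset_iff)
  have ne: "w \<noteq> p" "w \<noteq> u" "w \<noteq> v" "p \<noteq> u" "p \<noteq> v" "u \<noteq> v"
    using sgraph_edgeD[OF sg e(1)] sgraph_edgeD[OF sg e(2)] sgraph_edgeD[OF sg e(3)]
      sgraph_edgeD[OF sg e(4)] wp(2) uv(3) by auto
  have inV: "p \<in> V" "w \<in> V" using sgraph_edgeD[OF sg e(1)] sgraph_edgeD[OF sg e(2)] by auto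
  have sgH: "sgraph V H"
  proof (rule sgraphI)
    show "finite V" using sg by (simp add: sgraph_def)
    fix e assume "e \<in> H"
    then have "e = {u, v} \<or> e = {w, p} \<or> e \<in> E" by (auto simp: H_def)
    then show "\<exists>x y. e = {x, y} \<and> x \<noteq> y \<and> x \<in> V \<and> y \<in> V"
      using ne inV uv sgraph_edgeE[OF sg, of e] by metis
  qed
  note fin = finite_nbr[OF sg]
  have nu: "nbr H u = insert v (nbr E u)"
    using ne unfolding nbr_def H_def by (auto simp: doubleton_eq_iff)
  have nv: "nbr H v = insert u (nbr E v - {w, p})"
    using ne unfolding nbr_def H_def by (auto simp: doubleton_eq_iff)
  have nw: "nbr H w = insert p (nbr E w - {v})"
    using ne unfolding nbr_def H_def by (auto simp: doubleton_eq_iff)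
  have np: "nbr H p = insert w (nbr E p - {v})"
    using ne unfolding nbr_def H_def by (auto simp: doubleton_eq_iff)
  have nx: "nbr H x = nbr E x" if "x \<notin> {u, v, w, p}" for x
    using that unfolding nbr_def H_def by (auto simp: doubleton_eq_iff)
  have mem: "v \<in> nbr E w" "v \<in> nbr E p" "w \<notin> nbr E p" "p \<notin> nbr E w" "u \<notin> nbr E v"
    using e by (auto simp: nbr_iff insert_commute)
  have dw: "deg H w = deg E w" unfolding nw using mem fin[of w] by (intro card_exchange) auto
  have dp: "deg H p = deg E p" unfolding np using mem fin[of p] by (intro card_exchange) auto
  have dx: "deg H x = deg E x" if "x \<noteq> u" "x \<noteq> v" for x
    using that dw dp nx[of x] by (cases "x \<in> {w, p}") auto
  have "card (nbr E v - {w, p}) = deg E v - card {w, p}"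
    using w p by (intro card_Diff_subset) auto
  moreover have "card {w, p} \<le> deg E v" using w p fin[of v] by (intro card_mono) auto
  ultimately have dv: "deg H v = b" unfolding nv using mem fin[of v] ne deg by simp
  have sh: "shifted V E u v H"
    unfolding shifted_def using sgH uv dx nu dv nonadj fin[of u] deg by auto
  have E0: "{e \<in> H. u \<notin> e \<and> v \<notin> e} = insert {w, p} {e \<in> E. u \<notin> e \<and> v \<notin> e}"
    using ne unfolding H_def by auto
  let ?d = "deg E"
  let ?E0 = "{e \<in> E. u \<notin> e \<and> v \<notin> e}"
  have "sum (edge_wt ?d) {e \<in> H. u \<notin> e \<and> v \<notin> e} = sum (edge_wt ?d) ?E0 + f (?d w) (?d p)"
    using sgraph_finite_edges[OF sg] e unfolding E0 by (simp add: edge_wt_doubleton)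
  moreover have "nbr H u - {v} = nbr E u - {v}" using nu by auto
  moreover have "nbr H v - {u} = nbr E v - {u} - {w, p}" using nv by auto
  moreover have "{u, v} \<in> H" unfolding H_def by simp
  moreover have "(\<Sum>y\<in>nbr E v - {u}. f (Suc b) (?d y)) + (\<Sum>y\<in>nbr E u - {v}. f (?d u) (?d y))
     \<le> (\<Sum>y\<in>nbr E v - {u} - {w, p}. f b (?d y)) + (\<Sum>y\<in>nbr E u - {v}. f (Suc (?d u)) (?d y)) + (\<Sum>y\<in>{w, p}. f b (?d y))"
    using fin nested w p ne deg nbr_irrefl[OF sg] by (intro nested_gain) auto
  \<comment> \<open>As \<open>w\<close> and \<open>p\<close> have degree at least \<open>b\<close>,
    supermodularity bounds the left side by \<open>f b b + f (deg E w) (deg E p)\<close>, and the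
    new edge \<open>{u, v}\<close> beats \<open>f b b\<close>.\<close>
  moreover have "f b (?d w) + f b (?d p) < f (Suc (?d u)) b + f (?d w) (?d p)"
  proof -
    have "f (?d w) b - f b b \<le> f (?d w) (?d p) - f b (?d p)" using super b by blast
    moreover have "f b b < f (Suc (?d u)) b" using strict deg by simp
    ultimately show ?thesis using sym[of b "?d w"] by simp
  qed
  ultimately have less: "total E < total H"
    using total_split[OF sg uv(3)] total_split_shifted[OF sh] deg e ne by simp
  have uH: "(u, w) \<in> (adj H)\<^sup>*" "(u, p) \<in> (adj H)\<^sup>*" "(u, v) \<in> (adj H)\<^sup>*"
    using adjI[of _ H u] nu nested w p by auto
  have main: "(x, y) \<in> (adj H)\<^sup>*" if "{x, y} \<in> E" for x y
  proof (cases "{x, y} \<in> H")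
    case True then show ?thesis by (intro adjI) (simp add: nbr_iff)
  next
    case False
    then have "{x, y} = {v, w} \<or> {x, y} = {v, p}" using that by (auto simp: H_def)
    then have "(x = v \<and> y = w \<or> x = w \<and> y = v) \<or> (x = v \<and> y = p \<or> x = p \<and> y = v)"
      by (simp only: doubleton_eq_iff)
    moreover have "(v, w) \<in> (adj H)\<^sup>*" "(v, p) \<in> (adj H)\<^sup>*"
      using rtrancl_trans[OF sym_adj_rtrancl[OF uH(3)] uH(1)]
        rtrancl_trans[OF sym_adj_rtrancl[OF uH(3)] uH(2)] by auto
    ultimately show ?thesis using sym_adj_rtrancl by metis
  qed
  show ?thesis using improvableI[OF G sh deg(1) less main] .
qed

end

section \<open>Redistributing neighbours\<close>

text \<open>Greedy choice: a remaining element of largest value is added each time.\<close>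

lemma top_subset:
  fixes d :: "'a \<Rightarrow> nat"
  assumes "finite W" "k \<le> card W"
  shows "\<exists>P\<subseteq>W. card P = k \<and> (\<forall>x\<in>P. \<forall>y\<in>W - P. d y \<le> d x)"
  using assms(2)
proof (induction k)
  case 0 then show ?case by (intro exI[of _ "{}"]) auto
next
  case (Suc k)
  then obtain P where P: "P \<subseteq> W" "card P = k" "\<forall>x\<in>P. \<forall>y\<in>W - P. d y \<le> d x" by auto
  have finP: "finite P" using P assms finite_subset by blast
  have "W - P \<noteq> {}" using P Suc.prems by (metis Diff_eq_empty_iff Suc_n_not_le_n subset_antisym)
  then have "Max (d ` (W - P)) \<in> d ` (W - P)" using assms by (intro Max_in) auto
  then obtain m where m: "m \<in> W - P" "d m = Max (d ` (W - P))" by auto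
  then have "\<forall>y\<in>W - P. d y \<le> d m" using assms by auto
  then show ?case using P m finP by (intro exI[of _ "insert m P"]) auto
qed

text \<open>Inject \<open>Q\<close> into \<open>P\<close>; the values of \<open>h\<close> left over
  are nonnegative.\<close>

lemma sum_le_sum_dominated:
  fixes g h :: "'a \<Rightarrow> real"
  assumes "finite P" "finite Q" "card Q \<le> card P" "\<And>x y. y \<in> Q \<Longrightarrow> x \<in> P \<Longrightarrow> g y \<le> h x"
    and "\<And>x. x \<in> P \<Longrightarrow> 0 \<le> h x"
  shows "sum g Q \<le> sum h P"
proof -
  obtain i where i: "inj_on i Q" "i ` Q \<subseteq> P"
    using card_le_inj[OF assms(2,1,3)] by auto
  have "sum g Q \<le> (\<Sum>y\<in>Q. h (i y))" using assms(4) i by (intro sum_mono) auto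
  also have "\<dots> = sum h (i ` Q)" using i by (simp add: sum.reindex)
  also have "\<dots> \<le> sum h P" using assms i by (intro sum_mono2) auto
  finally show ?thesis .
qed

text \<open>Cut a walk from \<open>u\<close> to \<open>v\<close> at its first arrival at
  \<open>v\<close> and at the last earlier visit to \<open>u\<close>; the piece between avoids
  both.\<close>

lemma path_avoiding_ends:
  assumes G: "cgraph c V E" and uv: "u \<in> V" "v \<in> V" "u \<noteq> v" "{u, v} \<notin> E"
  obtains x y where "x \<in> nbr E u" "y \<in> nbr E v" "(x, y) \<in> (adj {e \<in> E. u \<notin> e \<and> v \<notin> e})\<^sup>*"
proof -
  let ?E0 = "{e \<in> E. u \<notin> e \<and> v \<notin> e}"
  let ?goal = "\<exists>x\<in>nbr E u. \<exists>y\<in>nbr E v. (x, y) \<in> (adj ?E0)\<^sup>*"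
  \<comment> \<open>Invariant: the desired piece is complete, or the walk is at \<open>u\<close>, or
    it is elsewhere and linked to a neighbour of \<open>u\<close> by a piece avoiding both
    ends.\<close>
  have reach: "?goal \<or> t = u \<or> t \<noteq> v \<and> (\<exists>x\<in>nbr E u. (x, t) \<in> (adj ?E0)\<^sup>*)" if "(u, t) \<in> (adj E)\<^sup>*" for t
    using that
  proof (induction rule: rtrancl_induct)
    case base then show ?case by simp
  next
    case (step s t)
    then have st: "{s, t} \<in> E" by (simp add: adj_def)
    from step.IH show ?case
    proof (elim disjE)
      assume ?goal then show ?thesis by blast
    next
      assume su: "s = u"
      then have "t \<in> nbr E u" using st by (simp add: nbr_iff)
      moreover have "t \<noteq> v" using su st uv by auto
      ultimately show ?thesis by blast
    next
      assume "s \<noteq> v \<and> (\<exists>x\<in>nbr E u. (x, s) \<in> (adj ?E0)\<^sup>*)"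
      then obtain x where 3: "s \<noteq> v" "x \<in> nbr E u" "(x, s) \<in> (adj ?E0)\<^sup>*" by blast
      show ?thesis
      proof (cases "t = v")
        case True
        then have "s \<in> nbr E v" using st by (simp add: nbr_iff insert_commute)
        then show ?thesis using 3 by blast
      next
        case False
        show ?thesis
        proof (cases "s = u \<or> t = u")
          case True
          then show ?thesis using False st by (auto simp: nbr_iff)
        next
          case su: False
          then have "(s, t) \<in> adj ?E0" using False st 3(1) by (auto simp: adj_def)
          then have "(x, t) \<in> (adj ?E0)\<^sup>*" using 3(3) by (rule rtrancl_into_rtrancl[rotated])
          then show ?thesis using False 3(2) by blast
        qed
      qed
    qed
  qed
  have "(u, v) \<in> (adj E)\<^sup>*" using G uv by (simp add: cgraph_def)
  from reach[OF this] have ?goal using uv(3) by (elim disjE conjE) simp_all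
  then obtain x y where "x \<in> nbr E u" "y \<in> nbr E v" "(x, y) \<in> (adj ?E0)\<^sup>*" by (elim bexE)
  then show thesis by (rule that)
qed

context edge_weight
begin

text \<open>Think of \<open>A\<close> and \<open>B\<close> as neighbours of \<open>u\<close> and
  \<open>v\<close>. Giving \<open>u\<close> the \<open>card A\<close> vertices of largest degree
  loses nothing, by supermodularity. Passing it one more vertex gains strictly, since those left to
  \<open>v\<close> have smaller degrees and are at most as many.\<close>

lemma regroup:
  fixes d :: "'a \<Rightarrow> nat"
  assumes "finite A" "finite B" "A \<inter> B = {}" "card B \<le> card A" "B \<noteq> {}" "Suc b \<le> a"
  shows "\<exists>P Q. P \<union> Q = A \<union> B \<and> P \<inter> Q = {} \<and> card P = Suc (card A) \<and> Suc (card Q) = card B \<and>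
     (\<Sum>y\<in>A. f a (d y)) + (\<Sum>y\<in>B. f (Suc b) (d y)) <
     (\<Sum>y\<in>P. f (Suc a) (d y)) + (\<Sum>y\<in>Q. f b (d y))"
proof -
  define W where "W = A \<union> B"
  have finW: "finite W" and cW: "card W = card A + card B"
    using assms by (auto simp: W_def card_Un_disjoint)
  obtain T where T: "T \<subseteq> W" "card T = card A" "\<forall>x\<in>T. \<forall>y\<in>W - T. d y \<le> d x"
    using top_subset[OF finW, of "card A" d] cW by auto
  have finT: "finite T" using T finW finite_subset by blast
  define R where "R = W - T"
  have R: "finite R" "card R = card B" "R \<inter> T = {}" "R \<union> T = W"
    using T finW finT cW by (auto simp: R_def card_Diff_subset)
  have "R \<noteq> {}" using R(2) assms by auto
  then obtain w where w: "w \<in> R" by blast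
  \<comment> \<open>\<open>?g y\<close> is the advantage of placing \<open>y\<close> on the side of
    degree \<open>a\<close>; by \<open>super\<close> it does not decrease with
    \<open>d y\<close>.\<close>
  let ?g = "\<lambda>y. f a (d y) - f (Suc b) (d y)"
  have split: "(\<Sum>y\<in>X. f a (d y)) + (\<Sum>y\<in>W - X. f (Suc b) (d y)) = sum ?g X + (\<Sum>y\<in>W. f (Suc b) (d y))"
    if "X \<subseteq> W" for X
    using sum.subset_diff[OF that finW, of "\<lambda>y. f (Suc b) (d y)"] by (simp add: sum_subtractf)
  have "sum ?g (A - T) \<le> sum ?g (T - A)"
  proof (rule sum_le_sum_dominated)
    show "card (A - T) \<le> card (T - A)"
      using card_Diff_subset_Int[of A T] card_Diff_subset_Int[of T A] T(2) assms finT by (simp add: Int_commute)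
    fix x y assume "y \<in> A - T" "x \<in> T - A"
    then have "d y \<le> d x" using T by (auto simp: W_def)
    then show "?g y \<le> ?g x" using super[of "Suc b" a "d y" "d x"] assms by simp
  qed (use assms finT mono in auto)
  moreover have "sum ?g A = sum ?g (A - T) + sum ?g (A \<inter> T)" "sum ?g T = sum ?g (T - A) + sum ?g (A \<inter> T)"
    using sum.Int_Diff[OF assms(1), of ?g T] sum.Int_Diff[OF finT, of ?g A] by (simp_all add: Int_commute)
  ultimately have "sum ?g A \<le> sum ?g T" by linarith
  moreover have "W - A = B" using assms by (auto simp: W_def)
  ultimately have 1: "(\<Sum>y\<in>A. f a (d y)) + (\<Sum>y\<in>B. f (Suc b) (d y)) \<le> (\<Sum>y\<in>T. f a (d y)) + (\<Sum>y\<in>R. f (Suc b) (d y))"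
    using split[of A] split[of T] T(1) by (simp add: W_def R_def)
  \<comment> \<open>Second stage: \<open>w\<close> changes sides, and the losses on
    \<open>R - {w}\<close> are dominated by increments on \<open>T\<close>.\<close>
  have "(\<Sum>y\<in>R - {w}. f (Suc b) (d y) - f b (d y)) \<le> (\<Sum>y\<in>T. f (Suc a) (d y) - f a (d y))"
  proof (rule sum_le_sum_dominated)
    show "card (R - {w}) \<le> card T" using R w T assms by simp
    fix x y assume "y \<in> R - {w}" "x \<in> T"
    then have "d y \<le> d x" using T by (auto simp: R_def)
    then show "f (Suc b) (d y) - f b (d y) \<le> f (Suc a) (d x) - f a (d x)"
      using increment_mono assms by simp
  qed (use R finT increment_nonneg in auto)
  moreover have "f (Suc b) (d w) < f (Suc a) (d w)" using strict assms by simp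
  moreover have "(\<Sum>y\<in>R. f (Suc b) (d y)) = f (Suc b) (d w) + (\<Sum>y\<in>R - {w}. f (Suc b) (d y))"
    using R w by (simp add: sum.remove)
  moreover have "(\<Sum>y\<in>insert w T. f (Suc a) (d y)) = f (Suc a) (d w) + (\<Sum>y\<in>T. f (Suc a) (d y))"
    using R w finT by (intro sum.insert) auto
  ultimately have 2: "(\<Sum>y\<in>T. f a (d y)) + (\<Sum>y\<in>R. f (Suc b) (d y)) <
     (\<Sum>y\<in>insert w T. f (Suc a) (d y)) + (\<Sum>y\<in>R - {w}. f b (d y))"
    by (simp add: sum_subtractf)
  show ?thesis
  proof (intro exI conjI)
    show "insert w T \<union> (R - {w}) = A \<union> B" using w R by (auto simp: W_def)
    show "insert w T \<inter> (R - {w}) = {}" using R by auto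
    show "card (insert w T) = Suc (card A)" using w R T finT by (subst card_insert_disjoint) auto
    show "Suc (card (R - {w})) = card B" using w R by (metis card_Suc_Diff1)
  qed (use 1 2 in linarith)
qed

text \<open>Preserving both union and intersection of the two sides preserves how many of
  \<open>u\<close>, \<open>v\<close> each other vertex is adjacent to. Once \<open>u\<close> and
  \<open>v\<close> are linked in \<open>H\<close>, every removed edge has a detour through
  them.\<close>

lemma rewire_improves:
  assumes G: "cgraph c V E" and uv: "u \<in> V" "v \<in> V" "u \<noteq> v"
    and deg: "deg E v = Suc b"
    and A: "A = nbr E u - {v}" and B: "B = nbr E v - {u}"
    and PQ: "P \<union> Q = A \<union> B" "P \<inter> Q = A \<inter> B" "card P = Suc (card A)" "Suc (card Q) = card B"
    and le: "Suc b \<le> deg E u"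
    and gain: "(\<Sum>y\<in>A. f (deg E u) (deg E y)) + (\<Sum>y\<in>B. f (Suc b) (deg E y)) <
       (\<Sum>y\<in>P. f (Suc (deg E u)) (deg E y)) + (\<Sum>y\<in>Q. f b (deg E y))"
    and conn: "{u, v} \<in> E \<or> (\<exists>x\<in>P. \<exists>y\<in>Q. (x, y) \<in> (adj {e \<in> E. u \<notin> e \<and> v \<notin> e})\<^sup>*)"
  shows "improvable c V E u (Suc b)"
proof -
  note sg = cgraph_sgraph[OF G]
  note fin = finite_nbr[OF sg]
  let ?E0 = "{e \<in> E. u \<notin> e \<and> v \<notin> e}"
  define H where "H = ?E0 \<union> (\<lambda>y. {u, y}) ` P \<union> (\<lambda>y. {v, y}) ` Q \<union> (E \<inter> {{u, v}})"
  have notin: "u \<notin> P" "v \<notin> P" "u \<notin> Q" "v \<notin> Q"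
    using PQ(1) nbr_irrefl[OF sg] unfolding A B by blast+
  have sub: "P \<subseteq> V" "Q \<subseteq> V" using PQ(1) nbr_subset[OF sg] unfolding A B by blast+
  have finPQ: "finite P" "finite Q" using sub sg finite_subset by (auto simp: sgraph_def)
  have sgH: "sgraph V H"
  proof (rule sgraphI)
    show "finite V" using sg by (simp add: sgraph_def)
    fix e assume "e \<in> H"
    then consider "e \<in> E" | y where "e = {u, y}" "y \<in> P" | y where "e = {v, y}" "y \<in> Q"
      by (auto simp: H_def)
    then show "\<exists>x y. e = {x, y} \<and> x \<noteq> y \<and> x \<in> V \<and> y \<in> V"
    proof cases
      case 1 then show ?thesis using sgraph_edgeE[OF sg, of e] by metis
    next
      case 2 then show ?thesis using notin sub uv by blast
    next
      case 3 then show ?thesis using notin sub uv by blast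
    qed
  qed
  have mem: "{x, y} \<in> H \<longleftrightarrow> ({x, y} \<in> E \<and> x \<noteq> u \<and> y \<noteq> u \<and> x \<noteq> v \<and> y \<noteq> v) \<or>
      (x = u \<and> y \<in> P \<or> y = u \<and> x \<in> P) \<or> (x = v \<and> y \<in> Q \<or> y = v \<and> x \<in> Q) \<or>
      {u, v} \<in> E \<and> (x = u \<and> y = v \<or> x = v \<and> y = u)" for x y
  proof -
    have 1: "{x, y} \<in> (\<lambda>y. {u, y}) ` P \<longleftrightarrow> x = u \<and> y \<in> P \<or> y = u \<and> x \<in> P"
      "{x, y} \<in> (\<lambda>y. {v, y}) ` Q \<longleftrightarrow> x = v \<and> y \<in> Q \<or> y = v \<and> x \<in> Q"
      unfolding image_iff doubleton_eq_iff by blast+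
    have 2: "{x, y} \<in> ?E0 \<longleftrightarrow> {x, y} \<in> E \<and> x \<noteq> u \<and> y \<noteq> u \<and> x \<noteq> v \<and> y \<noteq> v" by simp metis
    have 3: "{x, y} \<in> E \<inter> {{u, v}} \<longleftrightarrow> {u, v} \<in> E \<and> (x = u \<and> y = v \<or> x = v \<and> y = u)"
      unfolding Int_iff singleton_iff by (metis doubleton_eq_iff)
    show ?thesis by (simp only: H_def Un_iff 1 2 3 disj_assoc)
  qed
  have nu: "nbr H u = P \<union> (if {u, v} \<in> E then {v} else {})"
    using notin uv(3) by (auto simp: nbr_iff mem)
  have nv: "nbr H v = Q \<union> (if {u, v} \<in> E then {u} else {})"
    using notin uv(3) by (auto simp: nbr_iff mem)
  have nx: "nbr H x = (nbr E x - {u, v}) \<union> ((if x \<in> P then {u} else {}) \<union> (if x \<in> Q then {v} else {}))"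
    if "x \<noteq> u" "x \<noteq> v" for x
    using that by (auto simp: nbr_iff mem)
  have nxE: "nbr E x = (nbr E x - {u, v}) \<union> ((if x \<in> A then {u} else {}) \<union> (if x \<in> B then {v} else {}))"
    if "x \<noteq> u" "x \<noteq> v" for x
    using that uv nbr_sym[of x E u] nbr_sym[of x E v] unfolding A B by auto
  have card2: "card ((nbr E x - {u, v}) \<union> ((if p then {u} else {}) \<union> (if q then {v} else {})))
      = card (nbr E x - {u, v}) + ((if p then 1 else 0) + (if q then 1 else 0))" for x p q
    using fin[of x] uv by (subst card_Un_disjoint) auto
  have dx: "deg H x = deg E x" if "x \<noteq> u" "x \<noteq> v" for x
  proof -
    have "deg H x = card (nbr E x - {u, v}) + ((if x \<in> P then 1 else 0) + (if x \<in> Q then 1 else 0))"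
      using nx[OF that] card2 by simp
    also have "\<dots> = card (nbr E x - {u, v}) + ((if x \<in> A then 1 else 0) + (if x \<in> B then 1 else 0))"
      using PQ(1,2) by auto
    also have "\<dots> = deg E x" by (subst (2) nxE[OF that]) (rule card2[symmetric])
    finally show ?thesis .
  qed
  have "deg H u = card P + (if {u, v} \<in> E then 1 else 0)"
    unfolding nu using notin finPQ by simp
  then have du: "deg H u = Suc (deg E u)" using deg_split[OF sg uv(3)] PQ(3) A by simp
  have "deg H v = card Q + (if {u, v} \<in> E then 1 else 0)"
    unfolding nv using notin finPQ by simp
  moreover have "{v, u} \<in> E \<longleftrightarrow> {u, v} \<in> E" by (simp add: insert_commute)
  ultimately have dv: "deg H v = b"
    using deg_split[OF sg uv(3)[symmetric]] PQ(4) B deg by simp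
  have sh: "shifted V E u v H" unfolding shifted_def using sgH uv dx du dv deg by simp
  have "{e \<in> H. u \<notin> e \<and> v \<notin> e} = ?E0" unfolding H_def by auto
  moreover have "nbr H u - {v} = P" "nbr H v - {u} = Q" using nu nv notin by auto
  moreover have "{u, v} \<in> H \<longleftrightarrow> {u, v} \<in> E"
    using notin uv(3) by (simp add: mem)
  \<comment> \<open>The edge \<open>{u, v}\<close>, if present, has both end degrees changed;
    \<open>spread\<close> controls it.\<close>
  moreover have "f (deg E u) (Suc b) \<le> f (Suc (deg E u)) b" using spread le by simp
  ultimately have less: "total E < total H"
    using total_split[OF sg uv(3)] total_split_shifted[OF sh] gain deg by (simp add: A B)
  have uvH: "(u, v) \<in> (adj H)\<^sup>*"
  proof (cases "{u, v} \<in> E")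
    case True then show ?thesis using nu by (intro adjI) auto
  next
    case False
    then obtain x y where xy: "x \<in> P" "y \<in> Q" "(x, y) \<in> (adj ?E0)\<^sup>*" using conn by blast
    have "adj ?E0 \<subseteq> adj H" by (auto simp: adj_def H_def)
    then have "(x, y) \<in> (adj H)\<^sup>*" using xy(3) rtrancl_mono by blast
    moreover have "(u, x) \<in> (adj H)\<^sup>*" using nu xy by (intro adjI) auto
    moreover have "(v, y) \<in> (adj H)\<^sup>*" using nv xy by (intro adjI) auto
    ultimately show ?thesis using sym_adj_rtrancl rtrancl_trans by metis
  qed
  have uv_nbrs: "(u, y) \<in> (adj H)\<^sup>*" "(v, y) \<in> (adj H)\<^sup>*" if "y \<in> A \<union> B" for y
  proof -
    have "y \<in> P \<or> y \<in> Q" using that PQ(1) by blast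
    then have "(u, y) \<in> (adj H)\<^sup>* \<or> (v, y) \<in> (adj H)\<^sup>*"
      using nu nv adjI[of y H u] adjI[of y H v] by blast
    then show "(u, y) \<in> (adj H)\<^sup>*" "(v, y) \<in> (adj H)\<^sup>*"
      using uvH sym_adj_rtrancl rtrancl_trans by metis+
  qed
  have at_u: "(u, y) \<in> (adj H)\<^sup>*" if "{u, y} \<in> E" for y
    using that uvH uv_nbrs(1)[of y] by (cases "y = v") (auto simp: A nbr_iff)
  have at_v: "(v, y) \<in> (adj H)\<^sup>*" if "{v, y} \<in> E" for y
    using that sym_adj_rtrancl[OF uvH] uv_nbrs(2)[of y] by (cases "y = u") (auto simp: B nbr_iff)
  have main: "(x, y) \<in> (adj H)\<^sup>*" if xy: "{x, y} \<in> E" for x y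
  proof -
    have yx: "{y, x} \<in> E" using xy by (simp add: insert_commute)
    consider "x = u" | "y = u" | "x = v" | "y = v" | "u \<notin> {x, y}" "v \<notin> {x, y}" by blast
    then show ?thesis
    proof cases
      case 5
      then have "{x, y} \<in> H" using xy by (simp add: H_def)
      then show ?thesis by (intro adjI) (simp add: nbr_iff)
    qed (use xy yx at_u[of x] at_u[of y] at_v[of x] at_v[of y] sym_adj_rtrancl[of _ _ H] in simp_all)
  qed
  show ?thesis using improvableI[OF G sh deg less main] .
qed

text \<open>If \<open>u\<close> and \<open>v\<close> are adjacent or share a neighbour, their
  private neighbours may be regrouped freely. Otherwise each of \<open>u\<close> and
  \<open>v\<close> must retain one end of a connecting walk.\<close>

lemma unnested_improvable:
  assumes G: "cgraph c V E" and uv: "u \<in> V" "v \<in> V" "u \<noteq> v"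
    and deg: "deg E v = Suc b" "Suc b \<le> deg E u" and b: "b \<ge> 1"
    and unnested: "\<not> nbr E v - {u} \<subseteq> nbr E u"
  shows "improvable c V E u (Suc b)"
proof -
  note sg = cgraph_sgraph[OF G]
  define A where "A = nbr E u - {v}"
  define B where "B = nbr E v - {u}"
  have fin: "finite A" "finite B" using finite_nbr[OF sg] by (auto simp: A_def B_def)
  have BA: "B - A \<noteq> {}" using unnested nbr_irrefl[OF sg] by (auto simp: A_def B_def)
  have le: "card B \<le> card A"
    using deg deg_split[OF sg uv(3)] deg_split[OF sg uv(3)[symmetric]]
    by (auto simp: A_def B_def insert_commute split: if_splits)
  have ie: "card A = card (A - B) + card (A \<inter> B)" "card B = card (B - A) + card (A \<inter> B)"
    using fin card_Diff_subset_Int[of A B] card_Diff_subset_Int[of B A]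
      card_mono[of A "A \<inter> B"] card_mono[of B "A \<inter> B"] by (auto simp: Int_commute)
  let ?a = "deg E u"
  note rw = rewire_improves[OF G uv deg(1) A_def B_def _ _ _ _ deg(2)]
  show ?thesis
  proof (cases "{u, v} \<in> E \<or> A \<inter> B \<noteq> {}")
    case True
    obtain P Q where PQ: "P \<union> Q = (A - B) \<union> (B - A)" "P \<inter> Q = {}" "card P = Suc (card (A - B))"
        "Suc (card Q) = card (B - A)"
      and g: "(\<Sum>y\<in>A - B. f ?a (deg E y)) + (\<Sum>y\<in>B - A. f (Suc b) (deg E y)) <
         (\<Sum>y\<in>P. f (Suc ?a) (deg E y)) + (\<Sum>y\<in>Q. f b (deg E y))"
      using regroup[of "A - B" "B - A" b ?a "deg E"] fin BA le ie deg by auto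
    have finPQ: "finite P" "finite Q" using PQ(1) fin by (metis finite_Diff finite_Un)+
    have dj: "P \<inter> (A \<inter> B) = {}" "Q \<inter> (A \<inter> B) = {}" using PQ(1) by blast+
    show ?thesis
    proof (rule rw[of "P \<union> (A \<inter> B)" "Q \<union> (A \<inter> B)"])
      show "P \<union> (A \<inter> B) \<union> (Q \<union> (A \<inter> B)) = A \<union> B" using PQ(1) by blast
      show "(P \<union> (A \<inter> B)) \<inter> (Q \<union> (A \<inter> B)) = A \<inter> B" using PQ(2) by blast
      show "card (P \<union> (A \<inter> B)) = Suc (card A)"
        using dj finPQ fin PQ ie by (simp add: card_Un_disjoint)
      show "Suc (card (Q \<union> (A \<inter> B))) = card B"
        using dj finPQ fin PQ ie by (simp add: card_Un_disjoint)
      show "{u, v} \<in> E \<or> (\<exists>x\<in>P \<union> (A \<inter> B). \<exists>y\<in>Q \<union> (A \<inter> B). (x, y) \<in> (adj {e \<in> E. u \<notin> e \<and> v \<notin> e})\<^sup>*)"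
        using True by blast
      have "(\<Sum>y\<in>A \<inter> B. f (Suc b) (deg E y) - f b (deg E y)) \<le> (\<Sum>y\<in>A \<inter> B. f (Suc ?a) (deg E y) - f ?a (deg E y))"
        using deg by (intro sum_mono increment_mono) auto
      then have "(\<Sum>y\<in>A \<inter> B. f ?a (deg E y)) + (\<Sum>y\<in>A \<inter> B. f (Suc b) (deg E y)) \<le>
          (\<Sum>y\<in>A \<inter> B. f (Suc ?a) (deg E y)) + (\<Sum>y\<in>A \<inter> B. f b (deg E y))"
        by (simp add: sum_subtractf)
      moreover have "sum h A = sum h (A - B) + sum h (A \<inter> B)" "sum h B = sum h (B - A) + sum h (A \<inter> B)"
        for h :: "'a \<Rightarrow> real"
        using sum.Int_Diff[OF fin(1), of h B] sum.Int_Diff[OF fin(2), of h A] by (simp_all add: Int_commute)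
      ultimately show "(\<Sum>y\<in>A. f ?a (deg E y)) + (\<Sum>y\<in>B. f (Suc b) (deg E y)) <
         (\<Sum>y\<in>P \<union> (A \<inter> B). f (Suc ?a) (deg E y)) + (\<Sum>y\<in>Q \<union> (A \<inter> B). f b (deg E y))"
        using g dj finPQ fin by (simp add: sum.union_disjoint)
    qed
  next
    case False
    then have nonadj: "{u, v} \<notin> E" and dj: "A \<inter> B = {}" by auto
    obtain x y where xy: "x \<in> nbr E u" "y \<in> nbr E v" "(x, y) \<in> (adj {e \<in> E. u \<notin> e \<and> v \<notin> e})\<^sup>*"
      using path_avoiding_ends[OF G uv nonadj] by metis
    have xA: "x \<in> A" and yB: "y \<in> B"
      using xy nonadj by (auto simp: A_def B_def nbr_iff insert_commute)
    have cB: "card B = Suc b" using deg nonadj by (simp add: B_def nbr_iff insert_commute)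
    \<comment> \<open>Degree at least 2 at \<open>v\<close> leaves something to hand over after
      \<open>y\<close> is set aside.\<close>
    have ne: "B - {y} \<noteq> {}"
    proof
      assume "B - {y} = {}"
      then have "card (B - {y}) = 0" by (simp only: card.empty)
      then show False using cB b card_Suc_Diff1[OF fin(2) yB] by linarith
    qed
    have c1: "Suc (card (A - {x})) = card A" "Suc (card (B - {y})) = card B"
      using card_Suc_Diff1[OF fin(1) xA] card_Suc_Diff1[OF fin(2) yB] by simp_all
    obtain P Q where PQ: "P \<union> Q = (A - {x}) \<union> (B - {y})" "P \<inter> Q = {}" "card P = Suc (card (A - {x}))"
        "Suc (card Q) = card (B - {y})"
      and g: "(\<Sum>y\<in>A - {x}. f ?a (deg E y)) + (\<Sum>y\<in>B - {y}. f (Suc b) (deg E y)) <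
         (\<Sum>y\<in>P. f (Suc ?a) (deg E y)) + (\<Sum>y\<in>Q. f b (deg E y))"
      using regroup[of "A - {x}" "B - {y}" b ?a "deg E"] fin ne le c1 deg dj by auto
    have finPQ: "finite P" "finite Q" using PQ(1) fin by (metis finite_Diff finite_Un)+
    have out: "x \<notin> P" "y \<notin> P" "x \<notin> Q" "y \<notin> Q" "x \<noteq> y" using PQ(1) dj xA yB by blast+
    \<comment> \<open>\<open>s\<close> is to be the one of \<open>x\<close> and \<open>y\<close>
      with the larger degree; giving it to \<open>u\<close> keeps the comparison favourable.\<close>
    have go: ?thesis if s: "s = x \<and> t = y \<or> s = y \<and> t = x" and st: "deg E t \<le> deg E s" for s t
    proof (rule rw[of "insert s P" "insert t Q"])
      show "insert s P \<union> insert t Q = A \<union> B" using s PQ(1) xA yB by blast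
      show "insert s P \<inter> insert t Q = A \<inter> B" using s PQ(2) out dj by blast
      show "card (insert s P) = Suc (card A)" "Suc (card (insert t Q)) = card B"
        using s out finPQ PQ c1 by auto
      have "(s, t) \<in> (adj {e \<in> E. u \<notin> e \<and> v \<notin> e})\<^sup>*" 
        using s xy(3) sym_adj_rtrancl[OF xy(3)] by (elim disjE) simp_all
      then show "{u, v} \<in> E \<or> (\<exists>x\<in>insert s P. \<exists>y\<in>insert t Q. (x, y) \<in> (adj {e \<in> E. u \<notin> e \<and> v \<notin> e})\<^sup>*)"
        by blast
      have "f ?a (deg E x) + f (Suc b) (deg E y) \<le> f ?a (deg E s) + f (Suc b) (deg E t)"
        using s st super[of "Suc b" ?a "deg E t" "deg E s"] deg by auto
      moreover have "f (Suc b) (deg E t) - f b (deg E t) \<le> f (Suc ?a) (deg E s) - f ?a (deg E s)"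
        using increment_mono st deg by simp
      moreover have "(\<Sum>y\<in>A. f ?a (deg E y)) = f ?a (deg E x) + (\<Sum>y\<in>A - {x}. f ?a (deg E y))"
        "(\<Sum>y\<in>B. f (Suc b) (deg E y)) = f (Suc b) (deg E y) + (\<Sum>y\<in>B - {y}. f (Suc b) (deg E y))"
        using sum.remove[OF fin(1) xA] sum.remove[OF fin(2) yB] by blast+
      moreover have "s \<notin> P" "t \<notin> Q" using s out by auto
      ultimately show "(\<Sum>y\<in>A. f ?a (deg E y)) + (\<Sum>y\<in>B. f (Suc b) (deg E y)) <
         (\<Sum>y\<in>insert s P. f (Suc ?a) (deg E y)) + (\<Sum>y\<in>insert t Q. f b (deg E y))"
        using g finPQ by simp
    qed
    show ?thesis using go[of x y] go[of y x] by (cases "deg E y \<le> deg E x") simp_all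
  qed
qed

end

section \<open>Transfers in graphs with at most two independent cycles\<close>

lemma deg_ge_1: "sgraph V E \<Longrightarrow> {x, y} \<in> E \<Longrightarrow> 1 \<le> deg E x"
  using card_mono[OF finite_nbr, of V E "{y}" x] by (simp add: nbr_iff)

lemma deg_ge_2: "sgraph V E \<Longrightarrow> y \<in> nbr E x \<Longrightarrow> z \<in> nbr E x \<Longrightarrow> y \<noteq> z \<Longrightarrow> 2 \<le> deg E x"
  using card_mono[OF finite_nbr, of V E "{y, z}" x] by simp

text \<open>Some edge must leave \<open>{l, q}\<close>, and it cannot start at the leaf.\<close>

lemma leaf_nbr_deg:
  assumes G: "cgraph c V E" and l: "l \<in> V" "nbr E l = {q}" and "3 \<le> card V"
  shows "2 \<le> deg E q"
proof -
  note sg = cgraph_sgraph[OF G]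
  have lq: "l \<in> nbr E q" using l nbr_sym[of l E q] by simp
  have "q \<in> V" using l nbr_subset[OF sg, of l] by simp
  moreover have "{l, q} \<noteq> V" using assms(4) card_insert_le_m1[of 2 "{q}" l] by auto
  ultimately obtain x y where xy: "x \<in> {l, q}" "y \<in> V - {l, q}" "{x, y} \<in> E"
    using cgraph_exit_edge[OF G, of "{l, q}"] l by blast
  have "y \<in> nbr E x" using xy by (simp add: nbr_iff)
  then have "y \<in> nbr E q" using xy l by auto
  then show ?thesis using deg_ge_2[OF sg lq] xy by auto
qed

lemma sum_induced_deg:
  assumes sg: "sgraph V E" and "S \<subseteq> V"
  shows "(\<Sum>x\<in>S. card (nbr E x \<inter> S)) = 2 * card (inside E S)"
proof -
  have "sgraph S (inside E S)"
    using assms finite_subset unfolding sgraph_def inside_def by auto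
  moreover have "nbr (inside E S) x = nbr E x \<inter> S" if "x \<in> S" for x
    using that by (auto simp: nbr_def inside_def)
  ultimately show ?thesis using handshake[of S "inside E S"] by simp
qed

context edge_weight
begin

section \<open>Losing vertices of degree 2: switches with a leaf\<close>

lemma nested_two_switch_2:
  assumes G: "cgraph c V E" and uv: "u \<in> V" "v \<in> V" "u \<noteq> v"
    and deg: "deg E v = 2" "2 \<le> deg E u"
    and nested: "nbr E v - {u} \<subseteq> nbr E u"
    and w: "w \<in> nbr E v" "w \<noteq> u"
    and zp: "{z, p} \<in> E" and z: "z \<notin> nbr E u" "z \<noteq> u" "z \<noteq> v" and p: "p \<notin> nbr E w" "p \<noteq> w"
    and cond: "deg E p \<le> Suc (deg E u) \<or> deg E z \<le> deg E w"
  shows "improvable c V E u 2"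
proof -
  have "1 \<le> deg E p" using deg_ge_1[OF cgraph_sgraph[OF G], of p z] zp by (simp add: insert_commute)
  then show ?thesis
    using nested_two_switch[OF G uv, of 1 w z p] deg nested w zp z p cond by (simp add: numeral_2_eq_2)
qed

text \<open>The leaf edge \<open>{l, q}\<close> is switched away. If \<open>q\<close> is not
  adjacent to \<open>u\<close> it plays the part of \<open>z\<close>; otherwise it is not adjacent
  to \<open>w\<close> and plays that of \<open>p\<close>. Degree 1 of \<open>l\<close> meets
  \<open>cond\<close> either way.\<close>

lemma leaf_switch:
  assumes G: "cgraph c V E" and uv: "u \<in> V" "v \<in> V" "u \<noteq> v"
    and deg: "deg E v = 2" "2 \<le> deg E u"
    and nested: "nbr E v - {u} \<subseteq> nbr E u"
    and w: "w \<in> nbr E v" "w \<noteq> u"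
    and l: "nbr E l = {q}" "q \<noteq> u" "q \<noteq> w" "q \<notin> nbr E u \<or> q \<notin> nbr E w"
  shows "improvable c V E u 2"
proof -
  note sg = cgraph_sgraph[OF G]
  have lq: "{l, q} \<in> E" using l(1) nbr_iff[of q E l] by simp
  have dl: "deg E l = 1" using l by simp
  have wu: "w \<in> nbr E u" using w nested by blast
  have dw: "2 \<le> deg E w" using deg_ge_2[OF sg, of u w v] w wu uv nbr_sym[of w E u] nbr_sym[of w E v] by simp
  have ne: "l \<noteq> u" "l \<noteq> v" "l \<noteq> w" using dl deg dw by auto
  have lu: "l \<notin> nbr E u" "l \<notin> nbr E w" using l nbr_sym[of l E u] nbr_sym[of l E w] by auto
  have "q \<noteq> v" using lq lu ne nested nbr_iff[of l E v] by (auto simp: insert_commute)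
  show ?thesis
  proof (cases "q \<in> nbr E u")
    case False
    show ?thesis
      by (rule nested_two_switch_2[OF G uv deg nested w, of q l])
        (use False lq l ne lu \<open>q \<noteq> v\<close> dl in \<open>auto simp: insert_commute\<close>)
  next
    case True
    show ?thesis
      by (rule nested_two_switch_2[OF G uv deg nested w, of l q])
        (use True lq l ne lu dl dw in auto)
  qed
qed

text \<open>\<open>C\<close> misses a vertex of degree at least 2, so after absorbing its adjacent
  leaves a leaf \<open>l\<close> remains outside, attached to some \<open>q\<close> not in
  \<open>C\<close>. Were \<open>q\<close> adjacent to both \<open>u\<close> and \<open>w\<close>,
  adding it to \<open>C\<close> would violate sparsity; hence \<open>leaf_switch\<close>
  applies.\<close>

lemma tight_core_improvable:
  assumes G: "cgraph c V E" and uv: "u \<in> V" "v \<in> V" "u \<noteq> v"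
    and deg: "deg E v = 2" "2 \<le> deg E u"
    and nested: "nbr E v - {u} \<subseteq> nbr E u"
    and w: "w \<in> nbr E v" "w \<noteq> u"
    and C: "C \<subseteq> V" "tight c E C" "u \<in> C" "w \<in> C" "card C < card {x \<in> V. 2 \<le> deg E x}"
  shows "improvable c V E u 2"
proof -
  note sg = cgraph_sgraph[OF G]
  have finV: "finite V" and finC: "finite C" using sg C finite_subset by (auto simp: sgraph_def)
  define L where "L = {l \<in> V. deg E l = 1 \<and> nbr E l \<inter> C \<noteq> {}}"
  have "tight c E (C \<union> L)" using finV by (intro tight_Un[OF sg C(2) finC]) (auto simp: L_def)
  moreover have "C \<union> L \<noteq> V"
  proof
    assume "C \<union> L = V"
    then have "{x \<in> V. 2 \<le> deg E x} \<subseteq> C" by (auto simp: L_def)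
    then show False using C(5) finC card_mono by (metis leD)
  qed
  ultimately obtain l where l: "l \<in> V - (C \<union> L)" "deg E l = 1"
    using tight_leaf_outside[OF G, of "C \<union> L"] C by (auto simp: L_def)
  then obtain q where q: "nbr E l = {q}" using card_1_singletonE by metis
  have qV: "q \<in> V" and lq: "l \<in> nbr E q" using q nbr_subset[OF sg, of l] nbr_sym[of l E q] by auto
  have qC: "q \<notin> C" using l q by (auto simp: L_def)
  have "q \<notin> nbr E u \<or> q \<notin> nbr E w"
  proof (rule ccontr)
    assume "\<not> ?thesis"
    then have "{u, w} \<subseteq> nbr E q \<inter> C" using C nbr_sym[of q E u] nbr_sym[of q E w] by auto
    then have "card {u, w} \<le> card (nbr E q \<inter> C)" using finC by (intro card_mono) auto
    then have "2 \<le> card (nbr E q \<inter> C)" using w by simp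
    moreover have "card (inside E (insert q C)) + 1 \<le> card (insert q C) + c"
      using cgraph_sparse[OF G] C qV by simp
    ultimately show False
      using card_inside_insert[OF sg qC] C(2) finC qC by (simp add: tight_def)
  qed
  then show ?thesis
    using leaf_switch[OF G uv deg nested w q] qC C by blast
qed

text \<open>In the nested case \<open>u\<close>, \<open>v\<close> and the \<open>b + 1\<close>
  neighbours of \<open>v\<close> contain a complete bipartite graph, so \<open>b \<le> c\<close>.
  Two nonadjacent neighbours of \<open>v\<close> permit \<open>nested_join_switch\<close>; otherwise
  these neighbours form a clique, which is too dense up to one case.\<close>

lemma nonadj_improvable:
  assumes G: "cgraph c V E" and uv: "u \<in> V" "v \<in> V" "u \<noteq> v"
    and deg: "deg E v = Suc b" "Suc b \<le> deg E u" and b: "1 \<le> b"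
    and c: "c \<le> 2" and nonadj: "v \<notin> nbr E u"
    and many: "b = 1 \<Longrightarrow> 1 \<le> c \<Longrightarrow> c + 3 \<le> card {x \<in> V. 2 \<le> deg E x}"
  shows "improvable c V E u (Suc b)"
proof (cases "nbr E v - {u} \<subseteq> nbr E u")
  case False then show ?thesis using unnested_improvable[OF G uv deg b] by blast
next
  case nested: True
  note sg = cgraph_sgraph[OF G]
  note fin = finite_nbr[OF sg]
  have uv_nonadj: "u \<notin> nbr E v" using nonadj nbr_sym[of v E u] by simp
  then have sub: "nbr E v \<subseteq> nbr E u" using nested by blast
  have vv: "v \<notin> nbr E v" using nbr_irrefl[OF sg] by blast
  have inV: "nbr E v \<subseteq> V" using nbr_subset[OF sg] .
  have "b \<le> c"
  proof -
    let ?F = "(\<lambda>y. {u, y}) ` nbr E v \<union> (\<lambda>y. {v, y}) ` nbr E v"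
    have "card ?F + 1 \<le> card ({u, v} \<union> nbr E v) + c"
      by (rule cgraph_sparse_edges[OF G]) (use uv inV sub in \<open>auto simp: nbr_def\<close>)
    moreover have "card ?F = Suc b + Suc b"
      using deg fin uv uv_nonadj
      by (subst card_Un_disjoint) (auto simp: card_image inj_doubleton doubleton_eq_iff)
    moreover have "card ({u, v} \<union> nbr E v) = 2 + Suc b"
      using deg fin uv uv_nonadj vv by (subst card_Un_disjoint) auto
    ultimately show ?thesis by simp
  qed
  have dge: "2 \<le> deg E x" if "x \<in> nbr E v" for x
    using deg_ge_2[OF sg, of u x v] that sub uv nbr_sym[of x E u] nbr_sym[of x E v] by auto
  show ?thesis
  proof (cases "\<exists>x\<in>nbr E v. \<exists>y\<in>nbr E v. x \<noteq> y \<and> x \<notin> nbr E y")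
    case True
    then obtain x y where "x \<in> nbr E v" "y \<in> nbr E v" "x \<noteq> y" "x \<notin> nbr E y" by blast
    then show ?thesis
      using nested_join_switch[OF G uv deg nonadj sub, of x y] dge[of x] dge[of y] \<open>b \<le> c\<close> c by simp
  next
    case False
    then have clique: "{x, y} \<in> E" if "x \<in> nbr E v" "y \<in> nbr E v" "x \<noteq> y" for x y
      using that nbr_iff[of x E y] by (auto simp: insert_commute)
    have uE: "{u, x} \<in> E" and vE: "{v, x} \<in> E" if "x \<in> nbr E v" for x
      using that sub by (auto simp: nbr_def)
    have ne: "x \<noteq> u" "x \<noteq> v" if "x \<in> nbr E v" for x using that uv_nonadj vv by auto
    have "\<not> nbr E v \<subseteq> {x}" for x using card_mono[of "{x}" "nbr E v"] deg b by auto
    then obtain x y where xy: "x \<in> nbr E v" "y \<in> nbr E v" "x \<noteq> y" by blast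
    note e = uE[OF xy(1)] uE[OF xy(2)] vE[OF xy(1)] vE[OF xy(2)] clique[OF xy]
    note d = ne[OF xy(1)] ne[OF xy(2)] xy(3) uv(3)
    have xyV: "x \<in> V" "y \<in> V" using xy inV by auto
    consider "b = 1" | "b = 2" using b \<open>b \<le> c\<close> c by linarith
    then show ?thesis
    proof cases
      case 1
      \<comment> \<open>\<open>K_4\<close> without \<open>{u, v}\<close>: five edges on four
        vertices force \<open>c = 2\<close> and make the set tight.\<close>
      let ?C = "{u, v, x, y}" and ?F = "{{u, x}, {u, y}, {v, x}, {v, y}, {x, y}}"
      have cF: "card ?F = 5" using d by (simp add: card_insert_if doubleton_eq_iff)
      have cC: "card ?C = 4" using d by (simp add: card_insert_if)
      have "card ?F + 1 \<le> card ?C + c"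
        by (rule cgraph_sparse_edges[OF G]) (use uv xyV e in auto)
      then have c2: "c = 2" using cF cC c by simp
      have "card ?F \<le> card (inside E ?C)"
        using e by (intro card_mono finite_inside[OF sg]) (auto simp: inside_def)
      then have t: "tight c E ?C" using cF cC c2 by (simp add: tight_def)
      have "improvable c V E u 2"
        by (rule tight_core_improvable[OF G uv _ _ nested xy(1) d(1) _ t])
          (use 1 deg uv xyV many c2 cC in \<open>simp_all\<close>)
      then show ?thesis using 1 by (simp add: numeral_2_eq_2)
    next
      case 2
      have "\<not> nbr E v \<subseteq> {x, y}" using card_mono[of "{x, y}" "nbr E v"] deg 2 xy by auto
      then obtain t where t: "t \<in> nbr E v" "t \<noteq> x" "t \<noteq> y" by blast
      \<comment> \<open>Seven of the nine edges present already exceed the six that sparsity allows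
        on five vertices.\<close>
      let ?C = "{u, v, x, y, t}" and ?F = "{{u, x}, {u, y}, {u, t}, {v, x}, {v, y}, {v, t}, {x, y}}"
      note d' = d ne[OF t(1)] t(2,3)
      have cF: "card ?F = 7" using d' by (simp add: card_insert_if doubleton_eq_iff)
      have cC: "card ?C = 5" using d' by (simp add: card_insert_if)
      have "card ?F + 1 \<le> card ?C + c"
        by (rule cgraph_sparse_edges[OF G]) (use uv xyV e t inV uE[OF t(1)] vE[OF t(1)] in auto)
      then show ?thesis using cF cC c by simp
    qed
  qed
qed

text \<open>\<open>u\<close>, \<open>v\<close>, \<open>x\<close>, \<open>y\<close> span
  \<open>K_4\<close> without \<open>{x, y}\<close>, which uses up both independent cycles. By
  \<open>room\<close> there is then a leaf away from \<open>u\<close>, and its edge is switched: the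
  leaf joins \<open>u\<close>, its old neighbour joins \<open>x\<close> or \<open>y\<close>.\<close>

lemma adj_improvable_3:
  assumes G: "cgraph c V E" and uv: "u \<in> V" "v \<in> V" "u \<noteq> v"
    and deg: "deg E v = 3" "3 \<le> deg E u"
    and nested: "nbr E v - {u} \<subseteq> nbr E u" and adj: "u \<in> nbr E v"
    and c: "c \<le> 2" and room: "deg E u + 2 \<le> card V"
  shows "improvable c V E u 3"
proof -
  note sg = cgraph_sgraph[OF G]
  note fin = finite_nbr[OF sg]
  have "card (nbr E v - {u}) = 2" using deg adj fin by simp
  then obtain x y where xy: "nbr E v - {u} = {x, y}" "x \<noteq> y" by (meson card_2_iff)
  have mem: "x \<in> nbr E v" "y \<in> nbr E v" "x \<noteq> u" "y \<noteq> u" "x \<in> nbr E u" "y \<in> nbr E u" using xy nested by auto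
  have vu: "v \<in> nbr E u" using adj nbr_sym[of v E u] by simp
  have e: "{u, v} \<in> E" "{u, x} \<in> E" "{u, y} \<in> E" "{v, x} \<in> E" "{v, y} \<in> E"
    using mem vu by (simp_all add: nbr_iff)
  have d: "x \<noteq> u" "y \<noteq> u" "x \<noteq> v" "y \<noteq> v" "x \<noteq> y" "u \<noteq> v"
    using mem xy uv nbr_irrefl[OF sg, of v] by auto
  have inV: "x \<in> V" "y \<in> V" using mem nbr_subset[OF sg] by blast+
  have c2: "c = 2"
  proof -
    let ?F = "{{u, v}, {u, x}, {u, y}, {v, x}, {v, y}}"
    have "card ?F + 1 \<le> card {u, v, x, y} + c"
      by (rule cgraph_sparse_edges[OF G]) (use uv inV e in auto)
    moreover have "card ?F = 5" "card {u, v, x, y} = 4" using d by (simp_all add: card_insert_if doubleton_eq_iff)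
    ultimately show ?thesis using c by simp
  qed
  have nxy: "{x, y} \<notin> E"
  proof
    assume xyE: "{x, y} \<in> E"
    let ?F = "{{u, v}, {u, x}, {u, y}, {v, x}, {v, y}, {x, y}}"
    have "card ?F + 1 \<le> card {u, v, x, y} + c"
      by (rule cgraph_sparse_edges[OF G]) (use uv inV e xyE in auto)
    moreover have "card ?F = 6" "card {u, v, x, y} = 4" using d by (simp_all add: card_insert_if doubleton_eq_iff)
    ultimately show False using c by simp
  qed
  \<comment> \<open>The star at \<open>u\<close> plus \<open>{v, x}\<close> and
    \<open>{v, y}\<close> makes the closed neighbourhood of \<open>u\<close> tight;
    \<open>room\<close> makes it a proper subset of \<open>V\<close>.\<close>
  let ?X = "insert u (nbr E u)"
  have uu: "u \<notin> nbr E u" using nbr_irrefl[OF sg] by blast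
  have XV: "?X \<subseteq> V" using uv nbr_subset[OF sg] by blast
  have cX: "card ?X = Suc (deg E u)" using fin uu by simp
  have "tight c E ?X"
  proof -
    let ?F = "(\<lambda>y. {u, y}) ` nbr E u \<union> {{v, x}, {v, y}}"
    have "card ?F = deg E u + 2"
      using fin d by (subst card_Un_disjoint) (auto simp: card_image inj_doubleton doubleton_eq_iff)
    moreover have "card ?F \<le> card (inside E ?X)"
      using e mem vu by (intro card_mono finite_inside[OF sg]) (auto simp: inside_def nbr_def)
    ultimately show ?thesis using cX c2 by (simp add: tight_def)
  qed
  moreover have "?X \<noteq> V" using cX room by auto
  ultimately obtain l where l: "l \<in> V - ?X" "deg E l = 1" using tight_leaf_outside[OF G _ XV] by blast
  then obtain q where q: "nbr E l = {q}" using card_1_singletonE by metis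
  have qV: "q \<in> V" and lq: "l \<in> nbr E q" and lqE: "{l, q} \<in> E"
    using q nbr_subset[OF sg, of l] nbr_sym[of l E q] by (auto simp: nbr_def)
  have qu: "q \<noteq> u" using lq l by auto
  have lv: "l \<noteq> v" using l vu by auto
  have qv: "q \<noteq> v" using lq l nested by auto
  have dq: "2 \<le> deg E q" using leaf_nbr_deg[OF G _ q] l room deg by auto
  have key: "improvable c V E u 3" if w: "w \<in> nbr E v" "w \<noteq> u" "q \<notin> nbr E w" "q \<noteq> w" for w
  proof -
    have "1 \<le> deg E w" using deg_ge_1[OF sg, of w v] w by (simp add: nbr_iff insert_commute)
    then show ?thesis
      using nested_two_switch[OF G uv, of 2 w l q] deg nested w lqE l lv dq by (simp add: numeral_3_eq_3 numeral_2_eq_2)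
  qed
  \<comment> \<open>\<open>q\<close> cannot obstruct both choices of \<open>w\<close>: as a further
    common neighbour of \<open>x\<close> and \<open>y\<close> it would give seven edges on five
    vertices.\<close>
  show ?thesis
  proof (cases "q \<notin> nbr E x \<and> q \<noteq> x")
    case True then show ?thesis using key mem by blast
  next
    case False
    have "q \<noteq> y" using False nxy d by (auto simp: nbr_iff)
    moreover have "q \<notin> nbr E y"
    proof
      assume qy: "q \<in> nbr E y"
      then have "q \<noteq> x" using nxy by (auto simp: nbr_iff insert_commute)
      then have qx: "q \<in> nbr E x" using False by blast
      let ?F = "{{u, v}, {u, x}, {u, y}, {v, x}, {v, y}, {x, q}, {y, q}}"
      have "card ?F + 1 \<le> card {u, v, x, y, q} + c"
        by (rule cgraph_sparse_edges[OF G]) (use uv inV e qV qx qy in \<open>auto simp: nbr_def\<close>)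
      moreover have "card ?F = 7" "card {u, v, x, y, q} = 5"
        using d qu qv \<open>q \<noteq> x\<close> \<open>q \<noteq> y\<close> by (simp_all add: card_insert_if doubleton_eq_iff)
      ultimately show False using c by simp
    qed
    ultimately show ?thesis using key mem by blast
  qed
qed

lemma adj_improvable_2:
  assumes G: "cgraph c V E" and uv: "u \<in> V" "v \<in> V" "u \<noteq> v"
    and deg: "deg E v = 2" "2 \<le> deg E u"
    and nested: "nbr E v - {u} \<subseteq> nbr E u" and adj: "u \<in> nbr E v"
    and c: "c \<le> 2" and room: "deg E u + 2 \<le> card V"
    and many: "1 \<le> c \<Longrightarrow> c + 3 \<le> card {x \<in> V. 2 \<le> deg E x}"
  shows "improvable c V E u 2"
proof (rule ccontr)
  assume contra: "\<not> ?thesis"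
  note sg = cgraph_sgraph[OF G]
  note fin = finite_nbr[OF sg]
  have finV: "finite V" using sg by (simp add: sgraph_def)
  have "card (nbr E v - {u}) = 1" using deg adj fin by simp
  then obtain w where w: "nbr E v - {u} = {w}" by (meson card_1_singletonE)
  then have nv: "nbr E v = {u, w}" and wu: "w \<noteq> u" using adj by auto
  have wv: "w \<in> nbr E v" and wnu: "w \<in> nbr E u" using w nested by auto
  have vu: "v \<in> nbr E u" "v \<in> nbr E w" "u \<in> nbr E w"
    using adj wv wnu nbr_sym[of v E u] nbr_sym[of v E w] nbr_sym[of u E w] by auto
  have e: "{u, v} \<in> E" "{u, w} \<in> E" "{v, w} \<in> E" using wv wnu vu by (simp_all add: nbr_iff)
  have d: "w \<noteq> u" "w \<noteq> v" "u \<noteq> v" using wu uv wv nbr_irrefl[OF sg, of v] by auto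
  have wV: "w \<in> V" using wv nbr_subset[OF sg] by blast
  have dw: "2 \<le> deg E w" using deg_ge_2[OF sg vu(2,3)] uv by simp
  have core: False if "C \<subseteq> V" "tight c E C" "u \<in> C" "w \<in> C" "card C < card {x \<in> V. 2 \<le> deg E x}" for C
    using tight_core_improvable[OF G uv deg nested wv wu that] contra by simp
  have "3 + 1 \<le> 3 + c"
  proof -
    have "card {{u, v}, {u, w}, {v, w}} + 1 \<le> card {u, v, w} + c"
      by (rule cgraph_sparse_edges[OF G]) (use uv wV e in auto)
    then show ?thesis using d by (simp add: card_insert_if doubleton_eq_iff)
  qed
  then have c1: "1 \<le> c" by simp
  \<comment> \<open>For \<open>c = 1\<close> the triangle itself is tight.\<close>
  have c2: "c = 2"
  proof (rule ccontr)
    assume "c \<noteq> 2"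
    then have "c = 1" using c c1 by simp
    have "card {{u, v}, {u, w}, {v, w}} \<le> card (inside E {u, v, w})"
      using e by (intro card_mono finite_inside[OF sg]) (auto simp: inside_def)
    then have "tight c E {u, v, w}"
      using d \<open>c = 1\<close> by (simp add: tight_def card_insert_if doubleton_eq_iff)
    then show False using core[of "{u, v, w}"] uv wV d many[OF c1] \<open>c = 1\<close> by (simp add: card_insert_if)
  qed
  define S where "S = {x \<in> V. 2 \<le> deg E x}"
  have S5: "5 \<le> card S" using many[OF c1] c2 by (simp add: S_def)
  have finS: "finite S" and SV: "S \<subseteq> V" using finV by (auto simp: S_def)
  \<comment> \<open>Another common neighbour would complete a tight set of four vertices, while at
    least five have degree at least 2.\<close>
  have common: "t = v" if t: "t \<in> nbr E u" "t \<in> nbr E w" for t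
  proof (rule ccontr)
    assume tv: "t \<noteq> v"
    have d': "t \<noteq> u" "t \<noteq> w" "t \<in> V"
      using t nbr_irrefl[OF sg] nbr_subset[OF sg] by blast+
    let ?F = "{{u, v}, {u, w}, {v, w}, {u, t}, {w, t}}"
    have "card ?F \<le> card (inside E {u, v, w, t})"
      using e t by (intro card_mono finite_inside[OF sg]) (auto simp: inside_def nbr_def)
    moreover have "card ?F = 5" "card {u, v, w, t} = 4"
      using d d' tv by (simp_all add: card_insert_if doubleton_eq_iff)
    ultimately show False using core[of "{u, v, w, t}"] uv wV d' S5 c2 by (simp add: tight_def S_def)
  qed
  have pos: "1 \<le> deg E x" if "x \<in> V" for x using cgraph_deg_pos[OF G that] room by simp
  \<comment> \<open>\<open>v\<close> carries no leaf and is the only common neighbour of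
    \<open>u\<close> and \<open>w\<close>, so \<open>leaf_switch\<close> would apply to a leaf
    hanging elsewhere.\<close>
  have leaf: "q = u \<or> q = w" if l: "nbr E l = {q}" for l q
  proof (rule ccontr)
    assume q: "\<not> ?thesis"
    have "l \<in> nbr E q" using l nbr_sym[of l E q] by simp
    then have "q \<noteq> v" using nv l deg dw by auto
    then show False using leaf_switch[OF G uv deg nested wv wu l] q common contra by blast
  qed
  have leaf_free: "nbr E x \<subseteq> S" if x: "x \<noteq> u" "x \<noteq> w" for x
  proof
    fix y assume y: "y \<in> nbr E x"
    then have yV: "y \<in> V" and xy: "x \<in> nbr E y" using nbr_subset[OF sg] nbr_sym[of y E x] by auto
    have "deg E y \<noteq> 1"
    proof
      assume "deg E y = 1"
      then obtain q where "nbr E y = {q}" by (meson card_1_singletonE)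
      then show False using leaf[of y q] xy x by auto
    qed
    then show "y \<in> S" using pos[OF yV] yV by (simp add: S_def)
  qed
  have uvwS: "u \<in> S" "v \<in> S" "w \<in> S" using uv wV deg dw by (simp_all add: S_def)
  have ind: "2 \<le> card (nbr E x \<inter> S)" if x: "x \<in> S" for x
  proof -
    consider "x = u" | "x = w" | "x \<noteq> u" "x \<noteq> w" by blast
    then show ?thesis
    proof cases
      case 1
      have "card {v, w} \<le> card (nbr E u \<inter> S)" using vu wnu uvwS finS by (intro card_mono) auto
      then show ?thesis using 1 d by simp
    next
      case 2
      have "card {u, v} \<le> card (nbr E w \<inter> S)" using vu uvwS finS by (intro card_mono) auto
      then show ?thesis using 2 d by simp
    next
      case 3
      then have "nbr E x \<inter> S = nbr E x" using leaf_free by blast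
      then show ?thesis using x by (simp add: S_def)
    qed
  qed
  \<comment> \<open>Degrees inside \<open>S\<close> are at least 2, so their total surplus over 2 is
    at most 2.\<close>
  have ind_sum: "(\<Sum>x\<in>S. card (nbr E x \<inter> S)) \<le> 2 * card S + 2"
  proof -
    have "S \<noteq> {}" using uvwS by blast
    then show ?thesis using sum_induced_deg[OF sg SV] cgraph_sparse[OF G SV] c2 by simp
  qed
  \<comment> \<open>At degree 2, \<open>z\<close> itself would be a losing vertex not adjacent to
    \<open>u\<close>; larger degrees are excluded by counting edges around \<open>w\<close> and
    \<open>z\<close>.\<close>
  have far: "deg E z = 1" if z: "z \<in> V" "z \<noteq> u" "z \<notin> nbr E u" for z
  proof (rule ccontr)
    assume "deg E z \<noteq> 1"
    then have dz2: "2 \<le> deg E z" using pos[OF z(1)] by simp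
    have "deg E z \<noteq> 2"
    proof
      assume "deg E z = 2"
      then show False
        using nonadj_improvable[OF G uv(1) z(1), of 1] z c deg many contra by (simp add: numeral_2_eq_2)
    qed
    then have dz: "3 \<le> deg E z" using dz2 by simp
    have zvw: "z \<noteq> v" "z \<noteq> w" using z vu wnu by auto
    have zS: "z \<in> S" using dz z by (simp add: S_def)
    have near: "p \<in> nbr E w" if p: "p \<in> nbr E z" "p \<noteq> w" for p
    proof (rule ccontr)
      assume pw: "p \<notin> nbr E w"
      have "{z, p} \<in> E" using p by (simp add: nbr_iff)
      then have "\<not> (deg E p \<le> Suc (deg E u) \<or> deg E z \<le> deg E w)"
        using nested_two_switch_2[OF G uv deg nested wv wu _ z(3,2) zvw(1) pw p(2)] contra by blast
      then have dp: "4 \<le> deg E p" using deg by simp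
      have pu: "p \<noteq> u" using p z nbr_sym[of z E u] by auto
      have pS: "p \<in> S" using p dp nbr_subset[OF sg, of z] by (auto simp: S_def)
      have pz: "p \<noteq> z" using p nbr_irrefl[OF sg, of z] by auto
      have eq: "nbr E p \<inter> S = nbr E p" "nbr E z \<inter> S = nbr E z"
        using leaf_free[of p] leaf_free[of z] pu p z zvw by auto
      have "(\<Sum>x\<in>S - {p} - {z}. 2) \<le> (\<Sum>x\<in>S - {p} - {z}. card (nbr E x \<inter> S))"
        using ind by (intro sum_mono) auto
      moreover have "(\<Sum>x\<in>S. card (nbr E x \<inter> S)) = card (nbr E p \<inter> S) + (card (nbr E z \<inter> S) + (\<Sum>x\<in>S - {p} - {z}. card (nbr E x \<inter> S)))"
        using sum.remove[OF finS pS, of "\<lambda>x. card (nbr E x \<inter> S)"]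
          sum.remove[of "S - {p}" z "\<lambda>x. card (nbr E x \<inter> S)"] finS zS pz by simp
      moreover have "card (S - {p} - {z}) + 2 = card S"
        using finS pS zS pz S5 by simp
      ultimately show False using ind_sum eq dp dz by simp
    qed
    \<comment> \<open>Every vertex of \<open>M\<close> is joined to both \<open>w\<close> and
      \<open>z\<close>; with the triangle, and \<open>{z, w}\<close> if present, these are too many
      edges on \<open>{u, v, w, z} \<union> M\<close>.\<close>
    define M where "M = nbr E z - {w}"
    have M: "M \<subseteq> nbr E w" "finite M" "M \<subseteq> V" using near fin nbr_subset[OF sg] by (auto simp: M_def)
    have "v \<notin> nbr E z" using nv z zvw nbr_sym[of v E z] by auto
    moreover have "u \<notin> nbr E z" using z nbr_sym[of u E z] by simp
    ultimately have Mout: "u \<notin> M" "v \<notin> M" "w \<notin> M" "z \<notin> M" using nbr_irrefl[OF sg, of z] by (auto simp: M_def)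
    have cX: "card ({u, v, w, z} \<union> M) = 4 + card M"
      using M Mout d zvw z by (subst card_Un_disjoint) (auto simp: card_insert_if)
    let ?B = "if w \<in> nbr E z then {{u, v}, {u, w}, {v, w}, {z, w}} else {{u, v}, {u, w}, {v, w}}"
    let ?F = "?B \<union> ((\<lambda>y. {w, y}) ` M \<union> (\<lambda>y. {z, y}) ` M)"
    have "card ?F + 1 \<le> card ({u, v, w, z} \<union> M) + c"
      by (rule cgraph_sparse_edges[OF G])
        (use uv wV z M e in \<open>auto simp: nbr_def M_def split: if_splits\<close>)
    moreover have "card ?F = card ?B + (card M + card M)"
    proof -
      have "card ((\<lambda>y. {w, y}) ` M \<union> (\<lambda>y. {z, y}) ` M) = card M + card M"
        using M Mout zvw by (subst card_Un_disjoint) (auto simp: card_image inj_doubleton doubleton_eq_iff)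
      moreover have "?B \<inter> ((\<lambda>y. {w, y}) ` M \<union> (\<lambda>y. {z, y}) ` M) = {}"
      proof -
        have "e \<inter> M = {}" if "e \<in> ?B" for e using that Mout by (auto split: if_splits)
        then show ?thesis by blast
      qed
      ultimately show ?thesis using M by (subst card_Un_disjoint) auto
    qed
    moreover have "card ?B = 3 + (if w \<in> nbr E z then 1 else 0)"
      using d zvw z by (simp add: card_insert_if doubleton_eq_iff)
    moreover have "deg E z = card M + (if w \<in> nbr E z then 1 else 0)"
      using fin[of z] card_Suc_Diff1[OF fin, of w z] by (auto simp: M_def)
    ultimately show False using cX dz c2 by (simp split: if_splits)
  qed
  have near_u: "x \<in> nbr E u" if "x \<in> S" "x \<noteq> u" for x
    using far[of x] that by (auto simp: S_def)
  have "\<not> S \<subseteq> {u, v, w}"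
  proof
    assume "S \<subseteq> {u, v, w}"
    then have "card S \<le> card {u, v, w}" by (intro card_mono) auto
    then show False using S5 d by simp
  qed
  then obtain s where s: "s \<in> S" "s \<noteq> u" "s \<noteq> v" "s \<noteq> w" by blast
  have sV: "s \<in> V" using s SV by blast
  have su: "s \<in> nbr E u" "u \<in> nbr E s" using near_u s nbr_sym[of s E u] by auto
  have s_nbr: "x \<in> nbr E u \<and> x \<noteq> v \<and> x \<noteq> w \<and> x \<noteq> s \<and> x \<in> S" if x: "x \<in> nbr E s" "x \<noteq> u" for x
  proof -
    have "x \<in> S" using leaf_free[of s] s x by blast
    moreover have "x \<noteq> v" using x nv s nbr_sym[of x E s] by auto
    moreover have "x \<noteq> w" using x common su s nbr_sym[of x E s] by auto
    moreover have "x \<noteq> s" using x nbr_irrefl[OF sg, of s] by auto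
    ultimately show ?thesis using near_u x by blast
  qed
  have "\<not> nbr E s \<subseteq> {u}" using s(1) card_mono[of "{u}" "nbr E s"] by (auto simp: S_def)
  then obtain t where t: "t \<in> nbr E s" "t \<noteq> u" by blast
  note t' = s_nbr[OF t]
  \<comment> \<open>A further neighbour \<open>r\<close> would give eight edges on six vertices, one
    above the bound.\<close>
  have ns: "nbr E s = {u, t}"
  proof (rule ccontr)
    assume "nbr E s \<noteq> {u, t}"
    then obtain r where r: "r \<in> nbr E s" "r \<noteq> u" "r \<noteq> t" using su t by blast
    note r' = s_nbr[OF r(1,2)]
    have ne: "t \<noteq> v" "t \<noteq> w" "t \<noteq> s" "r \<noteq> v" "r \<noteq> w" "r \<noteq> s" using t' r' by auto
    let ?F = "{{u, v}, {u, w}, {v, w}, {u, s}, {u, t}, {u, r}, {s, t}, {s, r}}"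
    let ?C = "{u, v, w, s, t, r}"
    have "card ?F + 1 \<le> card ?C + c"
      by (rule cgraph_sparse_edges[OF G])
        (use uv wV sV SV e t t' r r' su in \<open>auto simp: nbr_iff\<close>)
    moreover have "card ?F = 8" "card ?C = 6"
      using d s(2-) t(2) r(2,3) ne by (simp_all add: card_insert_if doubleton_eq_iff)
    ultimately show False using c2 by simp
  qed
  have "\<not> V \<subseteq> insert u (nbr E u)"
  proof
    assume "V \<subseteq> insert u (nbr E u)"
    then have "card V \<le> card (insert u (nbr E u))" using fin by (intro card_mono) auto
    then show False using room card_insert_le_m1[of "Suc (deg E u)" "nbr E u" u] by simp
  qed
  then obtain l where l: "l \<in> V" "l \<noteq> u" "l \<notin> nbr E u" by blast
  then obtain q where q: "nbr E l = {q}" using far[OF l] by (meson card_1_singletonE)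
  have "q \<noteq> u" using q l nbr_sym[of u E l] by auto
  then have lw: "{l, w} \<in> E" using leaf[OF q] q by (auto simp: nbr_def)
  have dl: "deg E l = 1" using q by simp
  have ds: "deg E s = 2" using ns t by simp
  \<comment> \<open>Now \<open>s\<close> and \<open>t\<close> take the parts of \<open>v\<close> and
    \<open>w\<close>: the edges \<open>{s, t}\<close> and \<open>{l, w}\<close> are traded for
    \<open>{u, l}\<close> and \<open>{t, w}\<close>.\<close>
  have "improvable c V E u 2"
  proof (rule nested_two_switch_2[OF G uv(1) sV s(2)[symmetric] ds deg(2) _ t lw l(3,2)])
    show "nbr E s - {u} \<subseteq> nbr E u" using ns t' by auto
    show "l \<noteq> s" using ds dl by auto
    show "w \<notin> nbr E t" using common[of t] t' nbr_sym[of w E t] by auto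
    show "w \<noteq> t" using t' by auto
    show "deg E w \<le> Suc (deg E u) \<or> deg E l \<le> deg E t" using dl t' by (simp add: S_def)
  qed
  then show False using contra by simp
qed

text \<open>When \<open>u\<close> and \<open>v\<close> are adjacent and nested, \<open>b - 1\<close>
  triangles share the edge \<open>{u, v}\<close>; sparsity gives \<open>b - 1 \<le> c\<close>, so
  only degrees 2 and 3 remain.\<close>

theorem improvable_if_room:
  assumes G: "cgraph c V E" and uv: "u \<in> V" "v \<in> V" "u \<noteq> v"
    and deg: "deg E v = b" "b \<le> deg E u" "2 \<le> b"
    and c: "c \<le> 2" and room: "deg E u + 2 \<le> card V"
    and many: "b = 2 \<Longrightarrow> 1 \<le> c \<Longrightarrow> c + 3 \<le> card {x \<in> V. 2 \<le> deg E x}"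
  shows "improvable c V E u b"
proof -
  obtain b' where b': "b = Suc b'" "1 \<le> b'" using deg(3) by (cases b) auto
  note sg = cgraph_sgraph[OF G]
  note fin = finite_nbr[OF sg]
  show ?thesis
  proof (cases "v \<in> nbr E u \<and> nbr E v - {u} \<subseteq> nbr E u")
    case False
    then show ?thesis
      using unnested_improvable[OF G uv, of b'] nonadj_improvable[OF G uv, of b'] b' deg c many by auto
  next
    case True
    then have adj: "u \<in> nbr E v" and nested: "nbr E v - {u} \<subseteq> nbr E u" using nbr_sym[of v E u] by auto
    let ?M = "nbr E v - {u}"
    have cM: "card ?M = b'" using adj fin deg b' by simp
    let ?F = "{{u, v}} \<union> ((\<lambda>y. {u, y}) ` ?M \<union> (\<lambda>y. {v, y}) ` ?M)"
    have "card ?F + 1 \<le> card ({u, v} \<union> ?M) + c"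
      by (rule cgraph_sparse_edges[OF G])
        (use uv nested adj nbr_subset[OF sg, of v] in \<open>auto simp: nbr_def insert_commute\<close>)
    moreover have vM: "v \<notin> ?M" using nbr_irrefl[OF sg, of v] by simp
    have "card ((\<lambda>y. {u, y}) ` ?M \<union> (\<lambda>y. {v, y}) ` ?M) = b' + b'"
      using fin cM uv vM by (subst card_Un_disjoint) (auto simp: card_image inj_doubleton doubleton_eq_iff)
    then have "card ?F = 1 + (b' + b')"
      using fin vM by (subst card_Un_disjoint) (auto simp: doubleton_eq_iff)
    moreover have "card ({u, v} \<union> ?M) = 2 + b'"
      using fin cM uv vM by (subst card_Un_disjoint) auto
    ultimately have "b' \<le> 2" using c by simp
    then consider "b = 2" | "b = 3" using b' by linarith
    then show ?thesis
    proof cases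
      case 1 then show ?thesis using adj_improvable_2[OF G uv _ _ nested adj c room many] deg by simp
    next
      case 2 then show ?thesis using adj_improvable_3[OF G uv _ _ nested adj c room] deg by simp
    qed
  qed
qed

end

section \<open>Majorization and the generalised Sombor index\<close>

text \<open>Truncated subtraction makes this the function \<open>\<Phi>\<close>; its first
  differences count the vertices of degree above \<open>t\<close>.\<close>

definition excess :: "'a set \<Rightarrow> ('a \<Rightarrow> nat) \<Rightarrow> nat \<Rightarrow> nat" where
  "excess V d t = (\<Sum>x\<in>V. d x - t)"

lemma excess_Suc:
  assumes "finite V"
  shows "excess V d t = excess V d (Suc t) + card {x \<in> V. t < d x}"
proof -
  have "excess V d t = (\<Sum>x\<in>V. (d x - Suc t) + (if t < d x then 1 else 0))"
    unfolding excess_def by (intro sum.cong) auto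
  also have "\<dots> = excess V d (Suc t) + card {x \<in> V. t < d x}"
    using assms by (simp add: excess_def sum.distrib sum.If_cases Int_def)
  finally show ?thesis .
qed

lemma excess_eq_0: "(\<And>x. x \<in> V \<Longrightarrow> d x \<le> t) \<Longrightarrow> excess V d t = 0"
  by (simp add: excess_def)

lemma excess_posD: "0 < excess V d t \<Longrightarrow> \<exists>x\<in>V. t < d x"
  by (metis excess_eq_0 leI less_irrefl)

lemma count_image_mset_mset_set:
  "finite X \<Longrightarrow> count (image_mset g (mset_set X)) t = card {x \<in> X. g x = t}"
  by (simp add: count_image_mset vimage_def Int_def conj_commute)

lemma card_eq_zero_split:
  fixes g :: "'a \<Rightarrow> nat"
  assumes "finite X"
  shows "card X = card {x \<in> X. g x = 0} + card {x \<in> X. 0 < g x}"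
  using assms by (subst card_Un_disjoint[symmetric]) (auto intro!: arg_cong[where f = card])

lemma card_eq_Suc_split:
  fixes g :: "'a \<Rightarrow> nat"
  assumes "finite X"
  shows "card {x \<in> X. s < g x} = card {x \<in> X. g x = Suc s} + card {x \<in> X. Suc s < g x}"
  using assms by (subst card_Un_disjoint[symmetric]) (auto intro!: arg_cong[where f = card])

text \<open>Second differences count the vertices of each positive degree; the number of degree 0 is
  recovered from the number of all vertices.\<close>

lemma mset_degrees_eq_if_excess_eq:
  assumes "finite V" "finite W" "card V = card W" "\<And>t. excess V d t = excess W d' t"
  shows "image_mset d (mset_set V) = image_mset d' (mset_set W)"
proof (rule multiset_eqI)
  fix t
  have N: "card {x \<in> V. s < d x} = card {x \<in> W. s < d' x}" for s
    using excess_Suc[OF assms(1), of d s] excess_Suc[OF assms(2), of d' s] assms(4)[of s] assms(4)[of "Suc s"]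
    by simp
  have "card {x \<in> V. d x = t} = card {x \<in> W. d' x = t}"
  proof (cases t)
    case 0
    then show ?thesis
      using card_eq_zero_split[OF assms(1), of d] card_eq_zero_split[OF assms(2), of d'] N[of 0] assms(3) by simp
  next
    case (Suc s)
    then show ?thesis
      using card_eq_Suc_split[OF assms(1), of s d] card_eq_Suc_split[OF assms(2), of s d'] N[of s] N[of "Suc s"]
      by simp
  qed
  then show "count (image_mset d (mset_set V)) t = count (image_mset d' (mset_set W)) t"
    by (simp only: count_image_mset_mset_set assms)
qed

text \<open>On a maximal interval strictly between \<open>l\<close> and \<open>r\<close> where the
  functions differ, first differences at both ends show that at least two vertices have degree
  strictly between \<open>l\<close> and \<open>r\<close>.\<close>

lemma transfer_pair:
  fixes d :: "'a \<Rightarrow> nat" and d' :: "'b \<Rightarrow> nat"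
  assumes fin: "finite V" "finite W"
    and eq: "excess V d 0 = excess W d' 0" "excess V d 1 = excess W d' 1"
    and le: "\<And>t. excess V d t \<le> excess W d' t" and "excess V d t0 < excess W d' t0"
  obtains u v where "u \<in> V" "v \<in> V" "u \<noteq> v" "2 \<le> d v" "d v \<le> d u"
    "\<And>t. d v \<le> t \<Longrightarrow> t \<le> d u \<Longrightarrow> excess V d t < excess W d' t"
proof -
  let ?P = "excess V d" and ?Q = "excess W d'"
  have t0: "1 < t0"
  proof (rule ccontr)
    assume "\<not> 1 < t0"
    then have "t0 = 0 \<or> t0 = 1" by auto
    then show False using eq assms(6) by auto
  qed
  \<comment> \<open>Agreement at 0 and 1 makes the set nonempty and gives \<open>l \<ge> 1\<close>,
    so the degrees found will be at least 2.\<close>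
  define l where "l = Max {l. l < t0 \<and> ?P l = ?Q l}"
  have finL: "finite {l. l < t0 \<and> ?P l = ?Q l}" by simp
  have "l \<in> {l. l < t0 \<and> ?P l = ?Q l}" unfolding l_def
    using t0 eq by (intro Max_in[OF finL]) auto
  then have l: "l < t0" "?P l = ?Q l" by auto
  have l1: "1 \<le> l" unfolding l_def using t0 eq by (intro Max_ge[OF finL]) auto
  have lt_l: "?P t < ?Q t" if "l < t" "t \<le> t0" for t
  proof (rule ccontr)
    assume "\<not> ?thesis"
    then have "?P t = ?Q t" using le[of t] by simp
    moreover from this have "t \<noteq> t0" using assms(6) by auto
    ultimately have "t \<le> l" unfolding l_def using that by (intro Max_ge[OF finL]) auto
    then show False using that by simp
  qed
  \<comment> \<open>Beyond all degrees both functions vanish and agree again, so \<open>r\<close>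
    exists.\<close>
  define m where "m = Max (insert t0 (d ` V \<union> d' ` W))"
  have "?P (Suc m) = 0" "?Q (Suc m) = 0" "t0 < Suc m"
    using fin by (auto intro!: excess_eq_0 le_SucI simp: m_def less_Suc_eq_le)
  then have ex: "t0 < Suc m \<and> ?P (Suc m) = ?Q (Suc m)" by simp
  define r where "r = (LEAST r. t0 < r \<and> ?P r = ?Q r)"
  have r: "t0 < r" "?P r = ?Q r" using LeastI[of "\<lambda>r. t0 < r \<and> ?P r = ?Q r", OF ex] by (auto simp: r_def)
  have lt: "?P t < ?Q t" if "l < t" "t < r" for t
  proof (cases "t \<le> t0")
    case True then show ?thesis using lt_l that by simp
  next
    case False
    then have "?P t \<noteq> ?Q t" using not_less_Least[of t "\<lambda>r. t0 < r \<and> ?P r = ?Q r"] that by (auto simp: r_def)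
    then show ?thesis using le[of t] by simp
  qed
  obtain k where k: "r = Suc k" using r by (cases r) auto
  have lk: "Suc l \<le> k" using l r k by simp
  let ?N = "\<lambda>t. card {x \<in> V. t < d x}" and ?M = "\<lambda>t. card {x \<in> W. t < d' x}"
  have "?P (Suc l) < ?Q (Suc l)" "?P k < ?Q k" using lt[of "Suc l"] lt[of k] lk k by auto
  then have "?M l < ?N l" "?N k < ?M k"
    using excess_Suc[OF fin(1), of d l] excess_Suc[OF fin(2), of d' l]
      excess_Suc[OF fin(1), of d k] excess_Suc[OF fin(2), of d' k] l r k by auto
  \<comment> \<open>Thus \<open>?N k < ?M k \<le> ?M l < ?N l\<close>: two strict steps, hence a gap
    of at least 2.\<close>
  moreover have "?M k \<le> ?M l" using fin lk by (intro card_mono) auto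
  moreover have "?N l = card {x \<in> V. l < d x \<and> d x < r} + ?N k"
    using fin lk k by (subst card_Un_disjoint[symmetric]) (auto intro!: arg_cong[where f = card])
  ultimately have "2 \<le> card {x \<in> V. l < d x \<and> d x < r}" by simp
  then obtain T where "T \<subseteq> {x \<in> V. l < d x \<and> d x < r}" "card T = 2"
    by (meson obtain_subset_with_card_n)
  then obtain x y where xy: "x \<noteq> y" "x \<in> V" "y \<in> V" "l < d x" "d x < r" "l < d y" "d y < r"
    by (auto simp: card_2_iff)
  show thesis
  proof (cases "d y \<le> d x")
    case True then show thesis using that[of x y] xy lt l1 by auto
  next
    case False then show thesis using that[of y x] xy lt l1 by auto
  qed
qed

text \<open>Raising \<open>u\<close> adds 1 for \<open>t \<le> d u\<close>; lowering
  \<open>v\<close> takes away 1 for \<open>t < d v\<close>.\<close>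

lemma excess_shift:
  assumes fin: "finite V" and uv: "u \<in> V" "v \<in> V" "u \<noteq> v" and "1 \<le> d v" "d v \<le> d u"
    and d': "d' u = Suc (d u)" "d' v = d v - 1" "\<And>x. x \<noteq> u \<Longrightarrow> x \<noteq> v \<Longrightarrow> d' x = d x"
  shows "excess V d' t = excess V d t + (if d v \<le> t \<and> t \<le> d u then 1 else 0)"
proof -
  have split: "excess V g t = (g u - t) + ((g v - t) + (\<Sum>x\<in>V - {u} - {v}. g x - t))" for g
    using sum.remove[OF fin uv(1), of "\<lambda>x. g x - t"] sum.remove[of "V - {u}" v "\<lambda>x. g x - t"] fin uv
    by (simp add: excess_def)
  have "(\<Sum>x\<in>V - {u} - {v}. d' x - t) = (\<Sum>x\<in>V - {u} - {v}. d x - t)"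
    using d' by (intro sum.cong) auto
  then show ?thesis unfolding split[of d'] split[of d] using assms by auto
qed

text \<open>Each edge not inside \<open>S\<close> uses up a vertex of degree at most 1, so
  \<open>S\<close> spans at least \<open>card S + c - 1\<close> edges; comparison with
  \<open>card S choose 2\<close> excludes small \<open>S\<close>.\<close>

lemma core_size:
  assumes G: "cgraph c V E" and c: "1 \<le> c" "c \<le> 2"
  shows "c + 2 \<le> card {x \<in> V. 2 \<le> deg E x}"
proof -
  note sg = cgraph_sgraph[OF G]
  define S where "S = {x \<in> V. 2 \<le> deg E x}"
  have fin: "finite V" "finite S" "S \<subseteq> V" using sg by (auto simp: sgraph_def S_def)
  have finE: "finite E" using sgraph_finite_edges[OF sg] .
  have "{e \<in> E. \<not> e \<subseteq> S} \<subseteq> (\<Union>x\<in>V - S. {e \<in> E. x \<in> e})" using sg by (auto simp: sgraph_def)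
  then have "card {e \<in> E. \<not> e \<subseteq> S} \<le> card (\<Union>x\<in>V - S. {e \<in> E. x \<in> e})"
    using fin finE by (intro card_mono) auto
  also have "\<dots> \<le> (\<Sum>x\<in>V - S. deg E x)"
    using card_UN_le[of "V - S" "\<lambda>x. {e \<in> E. x \<in> e}"] fin by (simp add: deg_eq_card_edges[OF sg])
  also have "\<dots> \<le> (\<Sum>x\<in>V - S. 1)" by (intro sum_mono) (auto simp: S_def)
  finally have 1: "card {e \<in> E. \<not> e \<subseteq> S} \<le> card V - card S" using fin by (simp add: card_Diff_subset)
  have "card E = card (inside E S) + card {e \<in> E. \<not> e \<subseteq> S}"
    using finE unfolding inside_def by (subst card_Un_disjoint[symmetric]) (auto intro!: arg_cong[where f = card])
  moreover have "card S \<le> card V" using fin by (intro card_mono) auto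
  ultimately have 2: "card S + c \<le> card (inside E S) + 1" using 1 G unfolding cgraph_def by linarith
  have "inside E S \<subseteq> {e. e \<subseteq> S \<and> card e = 2}" using sg by (auto simp: inside_def sgraph_def)
  then have "card (inside E S) \<le> card {e. e \<subseteq> S \<and> card e = 2}" using fin by (intro card_mono) auto
  then have 3: "card S + c \<le> (card S choose 2) + 1" using 2 n_subsets[OF fin(2), of 2] by simp
  \<comment> \<open>For \<open>c = 1\<close> the binomial inequality admits the empty set; the
    handshake identity rules it out.\<close>
  have S0: "card S \<noteq> 0"
  proof
    assume "card S = 0"
    then have "S = {}" using fin by simp
    then have "\<forall>x\<in>V. deg E x \<le> 1" by (force simp: S_def)
    then have "(\<Sum>x\<in>V. deg E x) \<le> (\<Sum>x\<in>V. 1)" by (intro sum_mono) auto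
    then have "2 * card E \<le> card V" using handshake[OF sg] by simp
    then show False using G c fin card_gt_0_iff[of V] by (auto simp: cgraph_def)
  qed
  show ?thesis
  proof (rule ccontr)
    assume "\<not> ?thesis"
    then have "card S < c + 2" by (simp add: S_def)
    then have "card S \<in> {1, 2, 3}" "card S < c + 2" using S0 c by auto
    then show False using 3 c by (auto simp: choose_two)
  qed
qed

section \<open>Reaching the larger degree sequence by transfers\<close>

lemma deg_less_card: "sgraph V E \<Longrightarrow> x \<in> V \<Longrightarrow> deg E x < card V"
  using psubset_card_mono[of V "nbr E x"] nbr_subset[of V E x] nbr_irrefl[of V E x]
  by (auto simp: sgraph_def)

text \<open>Induction on the total deficit of \<open>excess\<close>, which every transfer lowers.
  The weak inequality is part of the claim because a transfer may already reach the target.\<close>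

lemma (in edge_weight) majorized_increase:
  fixes E' :: "'b set set"
  assumes G': "cgraph c W E'" and c: "c \<le> 2" and G: "cgraph c V E" and card: "card V = card W"
    and le: "\<And>t. excess V (deg E) t \<le> excess W (deg E') t"
  shows "\<exists>H. cgraph c V H \<and> (\<forall>t. excess V (deg H) t = excess W (deg E') t) \<and> total E \<le> total H \<and>
     ((\<exists>t. excess V (deg E) t \<noteq> excess W (deg E') t) \<longrightarrow> total E < total H)"
  using G le
proof (induction "\<Sum>t\<le>card V. excess W (deg E') t - excess V (deg E) t" arbitrary: E rule: less_induct)
  case (less E)
  note sg = cgraph_sgraph[OF less.prems(1)] and sg' = cgraph_sgraph[OF G']
  let ?P = "excess V (deg E)" and ?Q = "excess W (deg E')"
  have fin: "finite V" "finite W" using sg sg' by (auto simp: sgraph_def)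
  show ?case
  proof (cases "\<forall>t. ?P t = ?Q t")
    case True then show ?thesis using less.prems by (intro exI[of _ E]) auto
  next
    case False
    then obtain t0 where t0: "?P t0 < ?Q t0" using less.prems(2) by (metis order_le_neq_trans)
    \<comment> \<open>Strictness yields a vertex of positive degree, so there are two vertices and
      no degree is 0; hence the functions agree at 1 as well as at 0.\<close>
    obtain x' where "x' \<in> W" "t0 < deg E' x'" using excess_posD[of W "deg E'" t0] t0 by auto
    then have cV: "2 \<le> card V" using deg_less_card[OF sg', of x'] card by simp
    have P0: "?P 0 = ?Q 0"
      using handshake[OF sg] handshake[OF sg'] less.prems(1) G' card by (simp add: excess_def cgraph_def)
    have all: "{x \<in> V. 0 < deg E x} = V" "{x \<in> W. 0 < deg E' x} = W"
      using cgraph_deg_pos[OF less.prems(1)] cgraph_deg_pos[OF G'] cV card by fastforce+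
    have P1: "?P 1 = ?Q 1"
      using excess_Suc[OF fin(1), of "deg E" 0] excess_Suc[OF fin(2), of "deg E'" 0] P0 all card by simp
    obtain u v where uv: "u \<in> V" "v \<in> V" "u \<noteq> v" "2 \<le> deg E v" "deg E v \<le> deg E u"
      and lt: "\<And>t. deg E v \<le> t \<Longrightarrow> t \<le> deg E u \<Longrightarrow> ?P t < ?Q t"
      using transfer_pair[OF fin P0 P1 less.prems(2) t0] by metis
    \<comment> \<open>The target has a degree above \<open>deg E u\<close>, and that degree is below
      \<open>card W\<close>.\<close>
    have room: "deg E u + 2 \<le> card V"
    proof -
      have "0 < ?Q (deg E u)" using lt[of "deg E u"] uv by simp
      then obtain x where "x \<in> W" "deg E u < deg E' x" using excess_posD by blast
      then show ?thesis using deg_less_card[OF sg', of x] card by simp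
    qed
    \<comment> \<open>A transfer interval starting at 2 means that \<open>E\<close> has more
      vertices of degree at least 2 than \<open>E'\<close>, to which \<open>core_size\<close>
      applies.\<close>
    have many: "c + 3 \<le> card {x \<in> V. 2 \<le> deg E x}" if "deg E v = 2" "1 \<le> c"
    proof -
      have "?P 2 < ?Q 2" using lt[of 2] that uv by simp
      then have "card {x \<in> W. 1 < deg E' x} < card {x \<in> V. 1 < deg E x}"
        using excess_Suc[OF fin(1), of "deg E" 1] excess_Suc[OF fin(2), of "deg E'" 1] P1
        by (simp add: numeral_2_eq_2)
      moreover have "{x \<in> W. 1 < deg E' x} = {x \<in> W. 2 \<le> deg E' x}"
        "{x \<in> V. 1 < deg E x} = {x \<in> V. 2 \<le> deg E x}" by auto
      ultimately show ?thesis using core_size[OF G' that(2) c] by simp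
    qed
    obtain v' H where H: "deg E v' = deg E v" "shifted V E u v' H" "cgraph c V H" "total E < total H"
      using improvable_if_room[OF less.prems(1) uv(1-3) refl uv(5,4) c room many]
      unfolding improvable_def by blast
    have sh: "excess V (deg H) t = ?P t + (if deg E v \<le> t \<and> t \<le> deg E u then 1 else 0)" for t
      using excess_shift[OF fin(1), of u v' "deg E" "deg H" t] H(1,2) uv unfolding shifted_def by simp
    have leH: "excess V (deg H) t \<le> ?Q t" for t
      using sh[of t] lt[of t] less.prems(2)[of t] by auto
    have "(\<Sum>t\<le>card V. ?Q t - excess V (deg H) t) < (\<Sum>t\<le>card V. ?Q t - ?P t)"
    proof (rule sum_strict_mono_ex1)
      show "\<forall>t\<in>{..card V}. ?Q t - excess V (deg H) t \<le> ?Q t - ?P t" using sh by auto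
      have "?Q (deg E u) - excess V (deg H) (deg E u) < ?Q (deg E u) - ?P (deg E u)"
        using sh[of "deg E u"] lt[of "deg E u"] uv by simp
      then show "\<exists>t\<in>{..card V}. ?Q t - excess V (deg H) t < ?Q t - ?P t" using room by (intro bexI[of _ "deg E u"]) auto
    qed simp
    from less.hyps[OF this H(3) leH] obtain K where
      "cgraph c V K" "\<forall>t. excess V (deg K) t = ?Q t" "total H \<le> total K" by blast
    then show ?thesis using H(4) by (intro exI[of _ K]) auto
  qed
qed

section \<open>Transport along a bijection of the vertices\<close>

lemma cgraph_image:
  assumes G: "cgraph c V E" and bij: "bij_betw \<phi> V W"
  shows "cgraph c W ((`) \<phi> ` E)" "x \<in> V \<Longrightarrow> deg ((`) \<phi> ` E) (\<phi> x) = deg E x" "inj_on ((`) \<phi>) E"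
proof -
  note sg = cgraph_sgraph[OF G]
  have inj: "inj_on \<phi> V" and W: "W = \<phi> ` V" using bij by (auto simp: bij_betw_def)
  have EV: "\<And>e. e \<in> E \<Longrightarrow> e \<subseteq> V" using sg by (auto simp: sgraph_def)
  show injE: "inj_on ((`) \<phi>) E" using inj_on_image_eq_iff[OF inj] EV by (auto simp: inj_on_def)
  let ?E = "(`) \<phi> ` E"
  have mem: "{\<phi> x, \<phi> y} \<in> ?E \<longleftrightarrow> {x, y} \<in> E" if "x \<in> V" "y \<in> V" for x y
  proof
    assume "{\<phi> x, \<phi> y} \<in> ?E"
    then obtain e where e: "e \<in> E" "\<phi> ` {x, y} = \<phi> ` e" by auto
    then have "{x, y} = e" using inj_on_image_eq_iff[OF inj, of "{x, y}" e] EV that by simp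
    then show "{x, y} \<in> E" using e by simp
  next
    assume "{x, y} \<in> E"
    then have "\<phi> ` {x, y} \<in> ?E" by (rule imageI)
    then show "{\<phi> x, \<phi> y} \<in> ?E" by simp
  qed
  have nbr_eq: "nbr ?E (\<phi> x) = \<phi> ` nbr E x" if x: "x \<in> V" for x
  proof
    show "\<phi> ` nbr E x \<subseteq> nbr ?E (\<phi> x)" using mem x nbr_subset[OF sg, of x] by (auto simp: nbr_def)
    show "nbr ?E (\<phi> x) \<subseteq> \<phi> ` nbr E x"
    proof
      fix z assume "z \<in> nbr ?E (\<phi> x)"
      then have zE: "{\<phi> x, z} \<in> ?E" by (simp add: nbr_iff)
      then obtain e where "e \<in> E" "{\<phi> x, z} = \<phi> ` e" by blast
      then obtain y where y: "y \<in> V" "z = \<phi> y" using EV[of e] by blast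
      then have "{x, y} \<in> E" using zE mem[OF x] by simp
      then show "z \<in> \<phi> ` nbr E x" using y by (auto simp: nbr_iff)
    qed
  qed
  show "deg ?E (\<phi> x) = deg E x" if "x \<in> V"
    using nbr_eq[OF that] card_image[OF inj_on_subset[OF inj nbr_subset[OF sg, of x]]] by simp
  have conn: "(\<phi> x, \<phi> y) \<in> (adj ?E)\<^sup>*" if "x \<in> V" "(x, y) \<in> (adj E)\<^sup>*" for x y
    using that(2)
  proof (induction rule: rtrancl_induct)
    case base then show ?case by simp
  next
    case (step y z)
    then have "\<phi> ` {y, z} \<in> ?E" unfolding adj_def by blast
    then have "(\<phi> y, \<phi> z) \<in> adj ?E" by (simp add: adj_def)
    then show ?case using step.IH by (rule rtrancl_into_rtrancl[rotated])
  qed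
  have "sgraph W ?E"
    unfolding sgraph_def using sg EV W card_image[OF inj_on_subset[OF inj EV]] by (auto simp: sgraph_def)
  moreover have "card ?E = card E" using injE by (rule card_image)
  moreover have "card W = card V" using bij by (simp add: bij_betw_same_card)
  ultimately show "cgraph c W ?E" using G conn W unfolding cgraph_def by auto
qed

lemma (in edge_weight) total_image:
  assumes G: "cgraph c V E" and bij: "bij_betw \<phi> V W"
  shows "total ((`) \<phi> ` E) = total E"
proof -
  let ?E = "(`) \<phi> ` E"
  have "total ?E = (\<Sum>e\<in>E. edge_wt (deg ?E) (\<phi> ` e))"
    unfolding total_def using cgraph_image(3)[OF G bij] by (simp add: sum.reindex)
  also have "\<dots> = total E" unfolding total_def
  proof (rule sum.cong[OF refl])
    fix e assume "e \<in> E"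
    then have "e \<subseteq> V" using G by (auto simp: cgraph_def sgraph_def)
    then have "(\<lambda>x. deg ?E (\<phi> x)) ` e = deg E ` e"
      using cgraph_image(2)[OF G bij] by (intro image_cong) auto
    then have "deg ?E ` \<phi> ` e = deg E ` e" by (simp add: image_image)
    then show "edge_wt (deg ?E) (\<phi> ` e) = edge_wt (deg E) e" by (simp add: edge_wt_def)
  qed
  finally show ?thesis .
qed

section \<open>Majorization and truncated sums\<close>

text \<open>The entries above \<open>t\<close> form a prefix of a non-increasing list, and the
  others contribute 0.\<close>

lemma excess_prefix:
  assumes "sorted_wrt (\<ge>) xs"
  shows "\<exists>j\<le>length xs. real (sum_list (map (\<lambda>x. x - t) xs)) = sum_list (take j (map real xs)) - real j * real t"
  using assms
proof (induction xs)
  case Nil then show ?case by simp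
next
  case (Cons x xs)
  show ?case
  proof (cases "t < x")
    case True
    obtain j where "j \<le> length xs"
      "real (sum_list (map (\<lambda>x. x - t) xs)) = sum_list (take j (map real xs)) - real j * real t"
      using Cons by auto
    then show ?thesis using True by (intro exI[of _ "Suc j"]) (auto simp: algebra_simps of_nat_diff)
  next
    case False
    then have "\<forall>y\<in>set (x # xs). y - t = 0" using Cons.prems by auto
    then have "sum_list (map (\<lambda>x. x - t) (x # xs)) = 0" by (simp add: sum_list_eq_0_iff)
    then show ?thesis by (intro exI[of _ 0]) (simp only: of_nat_0 take_0 sum_list.Nil, simp)
  qed
qed

text \<open>Truncation only enlarges the terms of the prefix, and the terms beyond it are
  nonnegative.\<close>

lemma prefix_le_excess:
  "j \<le> length xs \<Longrightarrow> sum_list (take j (map real xs)) - real j * real t \<le> real (sum_list (map (\<lambda>x. x - t) xs))"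
proof (induction xs arbitrary: j)
  case Nil then show ?case by simp
next
  case (Cons x xs)
  show ?case
  proof (cases j)
    case 0 then show ?thesis by simp
  next
    case (Suc i)
    have "real x - real t \<le> real (x - t)" by simp
    then show ?thesis using Cons.IH[of i] Cons.prems Suc by (simp add: algebra_simps)
  qed
qed

text \<open>The prefix that is exact for \<open>xs\<close> still gives a lower bound for
  \<open>ys\<close>.\<close>

lemma majorized_excess_le:
  assumes "majorized_by (map real xs) (map real ys)"
  shows "sum_list (map (\<lambda>x. x - t) xs) \<le> sum_list (map (\<lambda>x. x - t) ys)"
proof -
  have "sorted_wrt (\<ge>) xs" using assms by (simp add: majorized_by_def sorted_wrt_map)
  then obtain j where j: "j \<le> length xs"
    "real (sum_list (map (\<lambda>x. x - t) xs)) = sum_list (take j (map real xs)) - real j * real t"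
    using excess_prefix by blast
  have len: "length xs = length ys" using assms by (auto simp: majorized_by_def dest: map_eq_imp_length_eq)
  \<comment> \<open>\<open>majorized_by\<close> speaks of \<open>j \<ge> 1\<close>; the empty prefix
    is treated apart.\<close>
  have "sum_list (take j (map real xs)) \<le> sum_list (take j (map real ys))"
    using assms j(1) by (cases "j = 0") (auto simp: majorized_by_def)
  then show ?thesis using j prefix_le_excess[of j ys t] len by linarith
qed

section \<open>The weight given by a power of the sum of squares\<close>

text \<open>For fixed \<open>h\<close> the difference has nonnegative derivative because
  \<open>a - 1 > 0\<close>. Only the open interval is differentiated, as \<open>s\<close> may be
  0.\<close>

lemma powr_increment_mono:
  fixes s s' h a :: real
  assumes "0 \<le> s" "s \<le> s'" "0 \<le> h" "1 < a"
  shows "(s + h) powr a - s powr a \<le> (s' + h) powr a - s' powr a"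
proof -
  have "\<exists>y. ((\<lambda>x. (x + h) powr a - x powr a) has_real_derivative y) (at x) \<and> 0 \<le> y" if "s < x" for x
  proof (intro exI conjI)
    have x: "0 < x" "0 < x + h" using that assms by auto
    show "((\<lambda>x. (x + h) powr a - x powr a) has_real_derivative a * (x + h) powr (a - 1) - a * x powr (a - 1)) (at x)"
      using x by (auto intro!: derivative_eq_intros)
    show "0 \<le> a * (x + h) powr (a - 1) - a * x powr (a - 1)"
      using x assms by (simp add: powr_mono2)
  qed
  moreover have "continuous_on {s..s'} (\<lambda>x. (x + h) powr a - x powr a)"
    using assms by (intro continuous_intros continuous_on_powr') auto
  ultimately show ?thesis
    using DERIV_nonneg_imp_increasing_open[of s s' "\<lambda>x. (x + h) powr a - x powr a"] assms by blast
qed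

lemma edge_weight_powr:
  assumes a: "1 < a"
  shows "edge_weight (\<lambda>x y. ((real x)\<^sup>2 + (real y)\<^sup>2) powr a)"
proof
  fix x x' y y' b :: nat
  show "((real x)\<^sup>2 + (real y)\<^sup>2) powr a = ((real y)\<^sup>2 + (real x)\<^sup>2) powr a" by (simp add: add.commute)
  show "((real x)\<^sup>2 + (real y)\<^sup>2) powr a < ((real x')\<^sup>2 + (real y)\<^sup>2) powr a" if "x < x'"
    using that a by (intro powr_less_mono2) (auto intro: power_strict_mono)
  \<comment> \<open>The increment \<open>x'^2 - x^2\<close> is compared at the bases
    \<open>x^2 + y^2\<close> and \<open>x^2 + y'^2\<close>.\<close>
  show "((real x')\<^sup>2 + (real y)\<^sup>2) powr a - ((real x)\<^sup>2 + (real y)\<^sup>2) powr a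
     \<le> ((real x')\<^sup>2 + (real y')\<^sup>2) powr a - ((real x)\<^sup>2 + (real y')\<^sup>2) powr a" if "x \<le> x'" "y \<le> y'"
    using powr_increment_mono[of "(real x)\<^sup>2 + (real y)\<^sup>2" "(real x)\<^sup>2 + (real y')\<^sup>2" "(real x')\<^sup>2 - (real x)\<^sup>2" a]
      that a by (simp add: power_mono algebra_simps)
  show "((real (Suc x))\<^sup>2 + (real y)\<^sup>2) powr a - ((real x)\<^sup>2 + (real y)\<^sup>2) powr a
     \<le> ((real (Suc x'))\<^sup>2 + (real y)\<^sup>2) powr a - ((real x')\<^sup>2 + (real y)\<^sup>2) powr a" if "x \<le> x'"
  proof -
    \<comment> \<open>A unit step adds \<open>2 x + 1\<close>: compare this increment at the larger
      base first, then enlarge it to \<open>2 x' + 1\<close>.\<close>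
    have "((real x)\<^sup>2 + (real y)\<^sup>2 + (2 * real x + 1)) powr a - ((real x)\<^sup>2 + (real y)\<^sup>2) powr a
      \<le> ((real x')\<^sup>2 + (real y)\<^sup>2 + (2 * real x + 1)) powr a - ((real x')\<^sup>2 + (real y)\<^sup>2) powr a"
      using that a by (intro powr_increment_mono) (auto simp: power_mono)
    moreover have "((real x')\<^sup>2 + (real y)\<^sup>2 + (2 * real x + 1)) powr a \<le> ((real x')\<^sup>2 + (real y)\<^sup>2 + (2 * real x' + 1)) powr a"
      using that a by (intro powr_mono2) auto
    moreover have sq: "(real (Suc n))\<^sup>2 + (real y)\<^sup>2 = (real n)\<^sup>2 + (real y)\<^sup>2 + (2 * real n + 1)" for n
      by (simp add: power2_eq_square algebra_simps)
    ultimately show ?thesis unfolding sq by linarith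
  qed
  \<comment> \<open>The two bases differ by \<open>2 (x - b)\<close>.\<close>
  show "((real x)\<^sup>2 + (real (Suc b))\<^sup>2) powr a \<le> ((real (Suc x))\<^sup>2 + (real b)\<^sup>2) powr a" if "b \<le> x"
    using that a by (intro powr_mono2) (auto simp: power2_eq_square algebra_simps)
qed

section \<open>Translation to the given definitions and conclusion\<close>

lemma degree_eq_deg: "simple_graph G \<Longrightarrow> degree G x = deg (edges G) x"
  using deg_eq_card_edges[of "verts G" "edges G" x]
  by (simp add: degree_def simple_graph_def sgraph_def)

lemma c_cyclic_iff_cgraph: "c_cyclic c G \<longleftrightarrow> cgraph c (verts G) (edges G)"
  by (auto simp: c_cyclic_def connected_graph_def simple_graph_def cgraph_def sgraph_def adj_def)

lemma degree_sequence_eq: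
  "simple_graph G \<Longrightarrow>
     degree_sequence G = rev (sorted_list_of_multiset (image_mset (deg (edges G)) (mset_set (verts G))))"
  by (simp add: degree_sequence_def degree_eq_deg cong: image_mset_cong)

lemma mset_degree_sequence:
  "simple_graph G \<Longrightarrow> mset (degree_sequence G) = image_mset (deg (edges G)) (mset_set (verts G))"
  by (simp add: degree_sequence_eq)

lemma excess_eq_sum_list:
  assumes "simple_graph G"
  shows "excess (verts G) (deg (edges G)) t = sum_list (map (\<lambda>x. x - t) (degree_sequence G))"
proof -
  have "sum_list (map (\<lambda>x. x - t) (degree_sequence G)) = sum_mset (image_mset (\<lambda>x. x - t) (mset (degree_sequence G)))"
    by (metis mset_map sum_mset_sum_list)
  then show ?thesis using assms
    by (simp add: mset_degree_sequence excess_def image_mset.compositionality sum_unfold_sum_mset o_def)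
qed

lemma length_degree_sequence: "simple_graph G \<Longrightarrow> length (degree_sequence G) = card (verts G)"
  using mset_degree_sequence[of G] by (metis size_image_mset size_mset size_mset_set)

text \<open>The degree sequence fixes the number of vertices and, by the handshake identity, of
  edges; so one c-cyclic realisation makes all of them c-cyclic.\<close>

lemma c_cyclic_if_same_degree_sequence:
  assumes "c_cyclic_degree_sequence c \<pi>" "G \<in> \<Gamma> \<pi>"
  shows "cgraph c (verts G) (edges G)"
proof -
  obtain K :: "nat ugraph" where K: "c_cyclic c K" "degree_sequence K = \<pi>"
    using assms by (auto simp: c_cyclic_degree_sequence_def)
  have G: "connected_graph G" "degree_sequence G = \<pi>" using assms by (auto simp: \<Gamma>_def)
  have s: "simple_graph K" "simple_graph G" using K G by (auto simp: c_cyclic_def connected_graph_def)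
  have "2 * card (edges K) = 2 * card (edges G)"
    using excess_eq_sum_list[OF s(1), of 0] excess_eq_sum_list[OF s(2), of 0] K(2) G(2)
      handshake[of "verts K" "edges K"] handshake[of "verts G" "edges G"] s
    by (simp add: excess_def simple_graph_def sgraph_def)
  moreover have "card (verts K) = card (verts G)"
    using length_degree_sequence[OF s(1)] length_degree_sequence[OF s(2)] K G by simp
  ultimately have "c_cyclic c G" using K G by (simp add: c_cyclic_def)
  then show ?thesis by (simp add: c_cyclic_iff_cgraph)
qed

lemma SO_eq_total:
  assumes "1 < \<alpha>" "simple_graph G"
  shows "SO \<alpha> G = edge_weight.total (\<lambda>x y. ((real x)\<^sup>2 + (real y)\<^sup>2) powr \<alpha>) (edges G)"
proof -
  interpret edge_weight "\<lambda>x y. ((real x)\<^sup>2 + (real y)\<^sup>2) powr \<alpha>" using edge_weight_powr[OF assms(1)] .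
  show ?thesis unfolding SO_def total_def
  proof (rule sum.cong[OF refl])
    fix e assume "e \<in> edges G"
    then obtain x y where "e = {x, y}" "x \<noteq> y" using assms(2) by (auto simp: simple_graph_def card_2_iff)
    then show "(\<Sum>u\<in>e. (real (degree G u))\<^sup>2) powr \<alpha> = edge_wt (deg (edges G)) e"
      by (simp add: edge_wt_doubleton degree_eq_deg[OF assms(2)])
  qed
qed

theorem theorem1p3:
  fixes c :: nat and \<pi> \<pi>' :: "nat list" and \<alpha> :: real
    and G :: "'a ugraph" and G' :: "'b ugraph"
  assumes "c \<in> {0, 1, 2}"
    and "c_cyclic_degree_sequence c \<pi>"
    and "c_cyclic_degree_sequence c \<pi>'"
    and "majorized_by (map real \<pi>) (map real \<pi>')"
    and "\<alpha> > 1"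
    and "is_arg_max (SO \<alpha>) (\<lambda>H. H \<in> \<Gamma> \<pi>) G"
    and "is_arg_max (SO \<alpha>) (\<lambda>H. H \<in> \<Gamma> \<pi>') G'"
  shows "SO \<alpha> G < SO \<alpha> G'"
proof -
  interpret edge_weight "\<lambda>x y. ((real x)\<^sup>2 + (real y)\<^sup>2) powr \<alpha>" using edge_weight_powr[OF assms(5)] .
  have G: "G \<in> \<Gamma> \<pi>" "G' \<in> \<Gamma> \<pi>'" using assms(6,7) by (auto simp: is_arg_max_def)
  have cg: "cgraph c (verts G) (edges G)" "cgraph c (verts G') (edges G')"
    using c_cyclic_if_same_degree_sequence assms(2,3) G by blast+
  have s: "simple_graph G" "simple_graph G'" and seq: "degree_sequence G = \<pi>" "degree_sequence G' = \<pi>'"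
    using G by (auto simp: \<Gamma>_def connected_graph_def)
  have fin: "finite (verts G)" "finite (verts G')" using s by (auto simp: simple_graph_def)
  have len: "length \<pi> = length \<pi>'" using assms(4) by (auto simp: majorized_by_def dest: map_eq_imp_length_eq)
  then have card: "card (verts G) = card (verts G')"
    using length_degree_sequence[OF s(1)] length_degree_sequence[OF s(2)] seq by simp
  have c: "c \<le> 2" using assms(1) by auto
  have le: "excess (verts G) (deg (edges G)) t \<le> excess (verts G') (deg (edges G')) t" for t
    using majorized_excess_le[OF assms(4)] excess_eq_sum_list[OF s(1)] excess_eq_sum_list[OF s(2)] seq by simp
  \<comment> \<open>Equal excess functions would give equal sorted degree sequences, but
    majorization is between different sequences.\<close>
  have "\<exists>t. excess (verts G) (deg (edges G)) t \<noteq> excess (verts G') (deg (edges G')) t"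
  proof (rule ccontr)
    assume "\<not> ?thesis"
    then have "image_mset (deg (edges G)) (mset_set (verts G)) = image_mset (deg (edges G')) (mset_set (verts G'))"
      using mset_degrees_eq_if_excess_eq[OF fin card] by blast
    then have "\<pi> = \<pi>'" using degree_sequence_eq[OF s(1)] degree_sequence_eq[OF s(2)] seq by simp
    then show False using assms(4) by (simp add: majorized_by_def)
  qed
  then obtain H where H: "cgraph c (verts G) H" "\<And>t. excess (verts G) (deg H) t = excess (verts G') (deg (edges G')) t"
    "total (edges G) < total H"
    using majorized_increase[OF cg(2) c cg(1) card le] by blast
  \<comment> \<open>\<open>H\<close> lives on the vertices of \<open>G\<close>; to compete with
    \<open>G'\<close> it is copied onto the vertices of \<open>G'\<close>, possibly of another
    type.\<close>
  obtain \<phi> where \<phi>: "bij_betw \<phi> (verts G) (verts G')" using finite_same_card_bij[OF fin card] by blast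
  define K where "K = \<lparr>verts = verts G', edges = (`) \<phi> ` H\<rparr>"
  have cK: "cgraph c (verts G') ((`) \<phi> ` H)" using cgraph_image(1)[OF H(1) \<phi>] .
  then have conK: "connected_graph K" and sK: "simple_graph K"
    using c_cyclic_iff_cgraph[of c K] by (auto simp: K_def c_cyclic_def connected_graph_def)
  have "mset_set (verts G') = image_mset \<phi> (mset_set (verts G))"
    using \<phi> by (metis bij_betw_def image_mset_mset_set)
  then have "image_mset (deg ((`) \<phi> ` H)) (mset_set (verts G')) = image_mset (\<lambda>x. deg ((`) \<phi> ` H) (\<phi> x)) (mset_set (verts G))"
    by (simp add: image_mset.compositionality o_def)
  also have "\<dots> = image_mset (deg H) (mset_set (verts G))"
    using cgraph_image(2)[OF H(1) \<phi>] fin by (intro image_mset_cong) simp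
  also have "\<dots> = image_mset (deg (edges G')) (mset_set (verts G'))"
    using mset_degrees_eq_if_excess_eq[OF fin card H(2)] .
  finally have "degree_sequence K = \<pi>'"
    using degree_sequence_eq[OF sK] degree_sequence_eq[OF s(2)] seq by (simp add: K_def)
  then have "K \<in> \<Gamma> \<pi>'" using conK by (simp add: \<Gamma>_def)
  then have "SO \<alpha> K \<le> SO \<alpha> G'" using assms(7) by (auto simp: is_arg_max_def)
  moreover have "SO \<alpha> K = total H"
    using SO_eq_total[OF assms(5) sK] total_image[OF H(1) \<phi>] by (simp add: K_def)
  ultimately show ?thesis using SO_eq_total[OF assms(5) s(1)] H(3) by simp
qed

end
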